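(* For each $n\in\mathbb N$ let $S_n$ be a densely defined closed symmetric operator in a Hilbert space $\mathfrak H_n$ with equal deficiency indices, let $\Pi_n=\{\mathcal H_n,\Gamma_0^{(n)},\Gamma_1^{(n)}\}$ be a boundary triplet for $S_n^*$, and let $M_n(\cdot)$ be the corresponding Weyl function. Then the direct sum $\Pi=\bigoplus_{n=1}^\infty\Pi_n$ forms an (ordinary) boundary triplet for the operator $A^*=\bigoplus_{n=1}^\infty S_n^*$ if and only if $$C_3=\sup_n\|M_n(\mathrm i)\|_{\mathcal H_n}<\infty\qquad\text{and}\qquad C_4=\sup_n\|(\operatorname{Im}M_n(\mathrm i))^{-1}\|_{\mathcal H_n}<\infty .$$
   Context: Boundary triplet: for a densely defined closed symmetric operator $S$ in a Hilbert space with equal deficiency indices, $\{\mathcal G,\Gamma_0,\Gamma_1\}$ is an (ordinary) boundary triplet for $S^*$ if $\mathcal G$ is a Hilbert space and $\Gamma_0,\Gamma_1:\operatorname{dom}(S^* )\to\mathcal G$ are linear mappings defined on all of $\operatorname{dom}(S^* )$, bounded with respect to the graph norm, such that $(S^*f,g)-(f,S^*g)=(\Gamma_1f,\Gamma_0g)_{\mathcal G}-(\Gamma_0f,\Gamma_1g)_{\mathcal G}$ for all $f,g\in\operatorname{dom}(S^* )$ and $\{\Gamma_0,\Gamma_1\}:\operatorname{dom}(S^* )\to\mathcal G\oplus\mathcal G$ is surjective. The corresponding Weyl function is $M(z)=\Gamma_1(\Gamma_0\upharpoonright\ker(S^*-z))^{-1}$ for $z\in\rho(S^*\upharpoonright\ker\Gamma_0)$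 (a bounded operator in $\mathcal G$); $\operatorname{Im}M=(M-M^* )/(2\mathrm i)$. Direct sum: $A=\bigoplus_nS_n$ acts in $\mathfrak H=\bigoplus_n\mathfrak H_n$; $\operatorname{dom}(A^* )=\{\bigoplus f_n\in\mathfrak H: f_n\in\operatorname{dom}(S_n^* ),\ \sum\|S_n^*f_n\|^2<\infty\}$. $\Pi=\bigoplus_n\Pi_n=\{\mathcal H,\Gamma_0,\Gamma_1\}$ with $\mathcal H=\bigoplus_n\mathcal H_n$, $\Gamma_j=\bigoplus_n\Gamma_j^{(n)}$, $\operatorname{dom}(\Gamma_j)=\{f=\bigoplus f_n\in\operatorname{dom}(A^* ):\sum_n\|\Gamma_j^{(n)}f_n\|^2<\infty\}$. That $\Pi$ is a boundary triplet for $A^*$ includes the requirement $\operatorname{dom}(\Gamma_0)=\operatorname{dom}(\Gamma_1)=\operatorname{dom}(A^* )$. *)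

theory Defs
  imports Complex_Main "HOL-Library.Function_Algebras" "HOL-Library.Extended_Nonnegative_Real"
begin

section \<open>Complex vector spaces and Hilbert spaces\<close>

class complex_vector = ab_group_add +
  fixes scaleC :: "complex \<Rightarrow> 'a \<Rightarrow> 'a"  (infixr "*\<^sub>C" 75)
  assumes scaleC_add_right: "c *\<^sub>C (x + y) = c *\<^sub>C x + c *\<^sub>C y"
    and scaleC_add_left: "(c + d) *\<^sub>C x = c *\<^sub>C x + d *\<^sub>C x"
    and scaleC_scaleC: "c *\<^sub>C (d *\<^sub>C x) = (c * d) *\<^sub>C x"
    and scaleC_one: "1 *\<^sub>C x = x"

instantiation "fun" :: (type, complex_vector) complex_vector
begin
definition scaleC_fun :: "complex \<Rightarrow> ('a \<Rightarrow> 'b) \<Rightarrow> 'a \<Rightarrow> 'b"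
  where "scaleC_fun c f = (\<lambda>x. c *\<^sub>C f x)"
instance
  by standard (auto simp: scaleC_fun_def plus_fun_def scaleC_add_right scaleC_add_left
      scaleC_scaleC scaleC_one)
end

definition csubspace :: "'a::complex_vector set \<Rightarrow> bool" where
  "csubspace V \<longleftrightarrow> 0 \<in> V \<and> (\<forall>x\<in>V. \<forall>y\<in>V. x + y \<in> V) \<and> (\<forall>c. \<forall>x\<in>V. c *\<^sub>C x \<in> V)"

text \<open>A Hilbert space is a linear subspace of an ambient complex vector space (a type), with an
  inner product of its own; the ambient type carries no topology. Countably many Hilbert spaces
  can always be realised inside one ambient type, for instance in the algebraic product of their
  underlying vector spaces, so that a sequence of spaces of this kind is an arbitrary sequence of
  Hilbert spaces. The direct sum below is again of this kind, inside a function type.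
  Inner products are linear in the first argument.\<close>

record 'a inner_space =
  carr :: "'a set"
  ip :: "'a \<Rightarrow> 'a \<Rightarrow> complex"

definition hnorm :: "'a inner_space \<Rightarrow> 'a \<Rightarrow> real" where
  "hnorm H x = sqrt (Re (ip H x x))"

locale complex_hilbert_space =
  fixes H :: "'a::complex_vector inner_space"
  assumes carr_subspace: "csubspace (carr H)"
    and ip_add_left: "\<lbrakk>x \<in> carr H; y \<in> carr H; z \<in> carr H\<rbrakk> \<Longrightarrow> ip H (x + y) z = ip H x z + ip H y z"
    and ip_scale_left: "\<lbrakk>x \<in> carr H; y \<in> carr H\<rbrakk> \<Longrightarrow> ip H (c *\<^sub>C x) y = c * ip H x y"
    and ip_cnj: "\<lbrakk>x \<in> carr H; y \<in> carr H\<rbrakk> \<Longrightarrow> ip H y x = cnj (ip H x y)"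
    and ip_pos: "\<lbrakk>x \<in> carr H; x \<noteq> 0\<rbrakk> \<Longrightarrow> Re (ip H x x) > 0"
    and complete: "\<lbrakk>\<And>n. X n \<in> carr H; \<forall>e>0. \<exists>N. \<forall>m\<ge>N. \<forall>n\<ge>N. hnorm H (X m - X n) < e\<rbrakk>
      \<Longrightarrow> \<exists>x\<in>carr H. (\<lambda>n::nat. hnorm H (X n - x)) \<longlonglongrightarrow> 0"

definition hilbert_sum :: "(nat \<Rightarrow> 'a::complex_vector inner_space) \<Rightarrow> (nat \<Rightarrow> 'a) inner_space" where
  "hilbert_sum H =
    \<lparr>carr = {f. (\<forall>n. f n \<in> carr (H n)) \<and> summable (\<lambda>n. (hnorm (H n) (f n))\<^sup>2)},
     ip = (\<lambda>f g. \<Sum>n. ip (H n) (f n) (g n))\<rparr>"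

section \<open>Linear operators\<close>

text \<open>An operator has an explicit domain; the values of \<open>app\<close> outside of it are irrelevant.\<close>

record ('a, 'b) operator =
  Dom :: "'a set"
  app :: "'a \<Rightarrow> 'b"

definition linear_operator ::
  "'a::complex_vector inner_space \<Rightarrow> 'b::complex_vector inner_space \<Rightarrow> ('a, 'b) operator \<Rightarrow> bool" where
  "linear_operator H K T \<longleftrightarrow>
     csubspace (Dom T) \<and> Dom T \<subseteq> carr H \<and> app T ` Dom T \<subseteq> carr K \<and>
     (\<forall>x\<in>Dom T. \<forall>y\<in>Dom T. app T (x + y) = app T x + app T y) \<and>
     (\<forall>c. \<forall>x\<in>Dom T. app T (c *\<^sub>C x) = c *\<^sub>C app T x)"

definition op_restrict :: "('a, 'b) operator \<Rightarrow> 'a set \<Rightarrow> ('a, 'b) operator" where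
  "op_restrict T V = \<lparr>Dom = Dom T \<inter> V, app = app T\<rparr>"

definition op_comp :: "('b, 'c) operator \<Rightarrow> ('a, 'b) operator \<Rightarrow> ('a, 'c) operator" where
  "op_comp T U = \<lparr>Dom = {x \<in> Dom U. app U x \<in> Dom T}, app = (\<lambda>x. app T (app U x))\<rparr>"

definition op_inverse :: "('a, 'b) operator \<Rightarrow> ('b, 'a) operator" where
  "op_inverse T = \<lparr>Dom = app T ` Dom T, app = inv_into (Dom T) (app T)\<rparr>"

definition op_diff :: "('a, 'b::complex_vector) operator \<Rightarrow> ('a, 'b) operator \<Rightarrow> ('a, 'b) operator" where
  "op_diff T U = \<lparr>Dom = Dom T \<inter> Dom U, app = (\<lambda>x. app T x - app U x)\<rparr>"

definition op_scale :: "complex \<Rightarrow> ('a, 'b::complex_vector) operator \<Rightarrow> ('a, 'b) operator" where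
  "op_scale c T = \<lparr>Dom = Dom T, app = (\<lambda>x. c *\<^sub>C app T x)\<rparr>"

text \<open>The kernel of \<open>T - z\<close>.\<close>

definition ker_shift :: "('a::complex_vector, 'a) operator \<Rightarrow> complex \<Rightarrow> 'a set" where
  "ker_shift T z = {f \<in> Dom T. app T f - z *\<^sub>C f = 0}"

text \<open>The operator norm, with value \<open>\<infinity>\<close> for unbounded operators.\<close>

definition op_norm :: "'a inner_space \<Rightarrow> 'b inner_space \<Rightarrow> ('a, 'b) operator \<Rightarrow> ennreal" where
  "op_norm H K T = (SUP x\<in>{x \<in> Dom T. hnorm H x \<le> 1}. ennreal (hnorm K (app T x)))"

definition densely_defined :: "'a::complex_vector inner_space \<Rightarrow> ('a, 'b) operator \<Rightarrow> bool" where
  "densely_defined H T \<longleftrightarrow> (\<forall>x\<in>carr H. \<forall>e>0. \<exists>y\<in>Dom T. hnorm H (x - y) < e)"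

definition closed_operator :: "'a::complex_vector inner_space \<Rightarrow> ('a, 'a) operator \<Rightarrow> bool" where
  "closed_operator H T \<longleftrightarrow>
     (\<forall>X. \<forall>x\<in>carr H. \<forall>y\<in>carr H.
        (\<forall>n::nat. X n \<in> Dom T) \<and> (\<lambda>n. hnorm H (X n - x)) \<longlonglongrightarrow> 0 \<and>
        (\<lambda>n. hnorm H (app T (X n) - y)) \<longlonglongrightarrow> 0 \<longrightarrow> x \<in> Dom T \<and> app T x = y)"

definition symmetric_operator :: "'a inner_space \<Rightarrow> ('a, 'a) operator \<Rightarrow> bool" where
  "symmetric_operator H T \<longleftrightarrow> (\<forall>f\<in>Dom T. \<forall>g\<in>Dom T. ip H (app T f) g = ip H f (app T g))"

text \<open>The value of the adjoint is unique when the operator is densely defined.\<close>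

definition op_adjoint :: "'a inner_space \<Rightarrow> ('a, 'a) operator \<Rightarrow> ('a, 'a) operator" where
  "op_adjoint H T =
    \<lparr>Dom = {g \<in> carr H. \<exists>h\<in>carr H. \<forall>f\<in>Dom T. ip H (app T f) g = ip H f h},
     app = (\<lambda>g. THE h. h \<in> carr H \<and> (\<forall>f\<in>Dom T. ip H (app T f) g = ip H f h))\<rparr>"

definition op_Im :: "'a::complex_vector inner_space \<Rightarrow> ('a, 'a) operator \<Rightarrow> ('a, 'a) operator" where
  "op_Im H T = op_scale (1 / (2 * \<i>)) (op_diff T (op_adjoint H T))"

definition orthonormal_basis :: "'a::complex_vector inner_space \<Rightarrow> 'a set \<Rightarrow> 'a set \<Rightarrow> bool" where
  "orthonormal_basis H V B \<longleftrightarrow>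
     B \<subseteq> V \<and> (\<forall>x\<in>B. \<forall>y\<in>B. ip H x y = (if x = y then 1 else 0)) \<and>
     (\<forall>x\<in>V. (\<forall>b\<in>B. ip H x b = 0) \<longrightarrow> x = 0)"

text \<open>The deficiency indices are the Hilbert space dimensions (arbitrary cardinals) of the
  kernels of \<open>S\<^sup>* - \<i>\<close> and \<open>S\<^sup>* + \<i>\<close>.\<close>

definition equal_deficiency_indices ::
  "'a::complex_vector inner_space \<Rightarrow> ('a, 'a) operator \<Rightarrow> bool" where
  "equal_deficiency_indices H S \<longleftrightarrow>
     (\<exists>B C \<phi>. orthonormal_basis H (ker_shift (op_adjoint H S) \<i>) B \<and>
        orthonormal_basis H (ker_shift (op_adjoint H S) (- \<i>)) C \<and> bij_betw \<phi> B C)"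

definition operator_sum ::
  "(nat \<Rightarrow> 'a::complex_vector inner_space) \<Rightarrow> (nat \<Rightarrow> 'b inner_space) \<Rightarrow>
   (nat \<Rightarrow> ('a, 'b) operator) \<Rightarrow> (nat \<Rightarrow> 'a, nat \<Rightarrow> 'b) operator" where
  "operator_sum H K T =
    \<lparr>Dom = {f \<in> carr (hilbert_sum H). (\<forall>n. f n \<in> Dom (T n)) \<and>
        summable (\<lambda>n. (hnorm (K n) (app (T n) (f n)))\<^sup>2)},
     app = (\<lambda>f n. app (T n) (f n))\<rparr>"

text \<open>The adjoint of the direct sum is the direct sum of the adjoints.\<close>

context complex_hilbert_space
begin

lemma carr_zero: "0 \<in> carr H" and carr_add: "\<lbrakk>x \<in> carr H; y \<in> carr H\<rbrakk> \<Longrightarrow> x + y \<in> carr H"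
  and carr_scale: "x \<in> carr H \<Longrightarrow> c *\<^sub>C x \<in> carr H"
  using carr_subspace by (auto simp: csubspace_def)

lemma scaleC_zero_left: "0 *\<^sub>C (x::'b::complex_vector) = 0"
  using scaleC_add_left[of 0 0 x] by simp

lemma scaleC_minus_one: "(- 1) *\<^sub>C (x::'b::complex_vector) = - x"
  using scaleC_add_left[of "- 1" 1 x]
  by (simp add: scaleC_zero_left scaleC_one eq_neg_iff_add_eq_0)

lemma carr_minus: "x \<in> carr H \<Longrightarrow> - x \<in> carr H"
  using carr_scale[of x "- 1"] by (simp add: scaleC_minus_one)

lemma carr_diff: "\<lbrakk>x \<in> carr H; y \<in> carr H\<rbrakk> \<Longrightarrow> x - y \<in> carr H"
  using carr_add[of x "- y"] carr_minus by simp

lemma ip_zero_left: "y \<in> carr H \<Longrightarrow> ip H 0 y = 0"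
  using ip_add_left[of 0 0 y] carr_zero by simp

lemma ip_zero_right: "y \<in> carr H \<Longrightarrow> ip H y 0 = 0"
  using ip_cnj[of 0 y] ip_zero_left[of y] carr_zero by simp

lemma ip_minus_left: "\<lbrakk>x \<in> carr H; y \<in> carr H\<rbrakk> \<Longrightarrow> ip H (- x) y = - ip H x y"
  using ip_scale_left[of x y "- 1"] by (simp add: scaleC_minus_one)

lemma ip_diff_left:
  "\<lbrakk>x \<in> carr H; y \<in> carr H; z \<in> carr H\<rbrakk> \<Longrightarrow> ip H (x - y) z = ip H x z - ip H y z"
  using ip_add_left[of x "- y" z] ip_minus_left[of y z] carr_minus by simp

lemma ip_diff_right:
  "\<lbrakk>x \<in> carr H; y \<in> carr H; z \<in> carr H\<rbrakk> \<Longrightarrow> ip H z (x - y) = ip H z x - ip H z y"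
  using ip_cnj[of "x - y" z] ip_cnj[of x z] ip_cnj[of y z]
  by (simp add: ip_diff_left carr_diff)

lemma ip_nonneg: "x \<in> carr H \<Longrightarrow> Re (ip H x x) \<ge> 0"
  using ip_pos[of x] ip_zero_left[OF carr_zero] by (cases "x = 0") auto

lemma hnorm_zero: "hnorm H 0 = 0"
  by (simp add: hnorm_def ip_zero_left carr_zero)

lemma orthogonal_dense_imp_zero:
  assumes T: "linear_operator H K T" "densely_defined H T" and x: "x \<in> carr H"
    and orth: "\<And>f. f \<in> Dom T \<Longrightarrow> ip H f x = 0"
  shows "x = 0"
proof (rule ccontr)
  assume "x \<noteq> 0"
  then have pos: "Re (ip H x x) > 0" using ip_pos x by blast
  then have "hnorm H x > 0" by (simp add: hnorm_def)
  then obtain f where f: "f \<in> Dom T" "hnorm H (x - f) < hnorm H x"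
    using T(2) x unfolding densely_defined_def by blast
  have fc: "f \<in> carr H" using f(1) T(1) by (auto simp: linear_operator_def)
  have "ip H x f = 0" using ip_cnj[OF fc x] orth[OF f(1)] by simp
  then have "ip H (x - f) (x - f) = ip H x x + ip H f f"
    using x fc orth[OF f(1)] by (simp add: ip_diff_left ip_diff_right carr_diff)
  then have "Re (ip H (x - f) (x - f)) \<ge> Re (ip H x x)"
    using ip_nonneg[OF fc] by simp
  then show False using f(2) by (simp add: hnorm_def)
qed

lemma op_adjoint_app:
  assumes T: "linear_operator H H T" "densely_defined H T" and g: "g \<in> carr H" and h: "h \<in> carr H"
    and eq: "\<And>f. f \<in> Dom T \<Longrightarrow> ip H (app T f) g = ip H f h"
  shows "g \<in> Dom (op_adjoint H T)" "app (op_adjoint H T) g = h"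
proof -
  show "g \<in> Dom (op_adjoint H T)" using g h eq by (auto simp: op_adjoint_def)
  have "h' = h" if h': "h' \<in> carr H" "\<forall>f\<in>Dom T. ip H (app T f) g = ip H f h'" for h'
  proof -
    have "ip H f (h' - h) = 0" if f: "f \<in> Dom T" for f
      using f h'(2) eq[OF f] h h'(1) T(1) by (auto simp: ip_diff_right linear_operator_def)
    then show ?thesis
      using orthogonal_dense_imp_zero[OF T carr_diff[OF h'(1) h]] by simp
  qed
  then show "app (op_adjoint H T) g = h"
    unfolding op_adjoint_def using h eq by (auto intro!: the_equality)
qed

lemma op_adjoint_ip:
  assumes T: "linear_operator H H T" "densely_defined H T" and g: "g \<in> Dom (op_adjoint H T)"
  shows "g \<in> carr H" "app (op_adjoint H T) g \<in> carr H"
    and "f \<in> Dom T \<Longrightarrow> ip H (app T f) g = ip H f (app (op_adjoint H T) g)"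
proof -
  obtain h where h: "g \<in> carr H" "h \<in> carr H" "\<And>f. f \<in> Dom T \<Longrightarrow> ip H (app T f) g = ip H f h"
    using g by (auto simp: op_adjoint_def)
  have "app (op_adjoint H T) g = h" using op_adjoint_app(2)[OF T h] by blast
  then show "g \<in> carr H" "app (op_adjoint H T) g \<in> carr H"
    "f \<in> Dom T \<Longrightarrow> ip H (app T f) g = ip H f (app (op_adjoint H T) g)" using h by auto
qed

end

lemma op_adjoint_operator_sum:
  assumes H: "\<And>n. complex_hilbert_space (H n)"
    and lin: "\<And>n. linear_operator (H n) (H n) (S n)"
    and dense: "\<And>n. densely_defined (H n) (S n)"
  defines "A \<equiv> operator_sum H H S" and "B \<equiv> operator_sum H H (\<lambda>n. op_adjoint (H n) (S n))"
  shows "Dom (op_adjoint (hilbert_sum H) A) = Dom B"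
    and "\<And>f. f \<in> Dom B \<Longrightarrow> app (op_adjoint (hilbert_sum H) A) f = app B f"
proof -
  let ?H = "hilbert_sum H"
  have sub: "Dom (S n) \<subseteq> carr (H n)" "app (S n) ` Dom (S n) \<subseteq> carr (H n)" "0 \<in> Dom (S n)" for n
    using lin[of n] by (auto simp: linear_operator_def csubspace_def)
  have S0: "app (S n) 0 = 0" for n
    using lin[of n] unfolding linear_operator_def csubspace_def
    by (metis add.right_neutral add_left_cancel)
  have comp: "g n \<in> Dom (op_adjoint (H n) (S n)) \<and> app (op_adjoint (H n) (S n)) (g n) = h n"
    if g: "g \<in> carr ?H" and h: "h \<in> carr ?H"
      and eq: "\<And>f. f \<in> Dom A \<Longrightarrow> ip ?H (app A f) g = ip ?H f h" for g h n
  proof -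
    have gc: "g m \<in> carr (H m)" "h m \<in> carr (H m)" for m
      using g h by (auto simp: hilbert_sum_def)
    have "ip (H n) (app (S n) u) (g n) = ip (H n) u (h n)" if u: "u \<in> Dom (S n)" for u
    proof -
      define f where "f = (\<lambda>m. if m = n then u else 0)"
      have fD: "f m \<in> Dom (S m)" for m using u sub(3) by (auto simp: f_def)
      have z: "hnorm (H m) (f m) = 0" "hnorm (H m) (app (S m) (f m)) = 0"
        "ip (H m) (app (S m) (f m)) (g m) = 0" "ip (H m) (f m) (h m) = 0" if "m \<noteq> n" for m
        using that complex_hilbert_space.hnorm_zero[OF H, of m]
          complex_hilbert_space.ip_zero_left[OF H, of _ m] gc[of m] by (auto simp: f_def S0)
      have "summable (\<lambda>m. (hnorm (H m) (f m))\<^sup>2)"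
        "summable (\<lambda>m. (hnorm (H m) (app (S m) (f m)))\<^sup>2)"
        by (rule summable_finite[of "{n}"]; use z in simp)+
      then have "f \<in> Dom A"
        using fD sub(1) unfolding A_def operator_sum_def hilbert_sum_def by auto
      from eq[OF this]
      have "(\<Sum>m. ip (H m) (app (S m) (f m)) (g m)) = (\<Sum>m. ip (H m) (f m) (h m))"
        by (simp add: A_def operator_sum_def hilbert_sum_def)
      moreover have "(\<Sum>m. ip (H m) (app (S m) (f m)) (g m)) = ip (H n) (app (S n) (f n)) (g n)"
        by (subst suminf_finite[of "{n}"]) (use z in auto)
      moreover have "(\<Sum>m. ip (H m) (f m) (h m)) = ip (H n) (f n) (h n)"
        by (subst suminf_finite[of "{n}"]) (use z in auto)
      ultimately show ?thesis by (simp add: f_def)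
    qed
    from complex_hilbert_space.op_adjoint_app[OF H lin dense gc this] show ?thesis by simp
  qed
  have fwd: "g \<in> Dom B \<and> h = app B g"
    if g: "g \<in> carr ?H" and h: "h \<in> carr ?H"
      and eq: "\<And>f. f \<in> Dom A \<Longrightarrow> ip ?H (app A f) g = ip ?H f h" for g h
  proof -
    have c: "g n \<in> Dom (op_adjoint (H n) (S n))" "app (op_adjoint (H n) (S n)) (g n) = h n" for n
      using comp[OF g h eq, of n] by blast+
    show ?thesis using g h by (simp add: B_def operator_sum_def hilbert_sum_def c)
  qed
  have bwd: "g \<in> carr ?H \<and> app B g \<in> carr ?H \<and> (\<forall>f\<in>Dom A. ip ?H (app A f) g = ip ?H f (app B g))"
    if g: "g \<in> Dom B" for g
  proof -
    have gn: "g n \<in> Dom (op_adjoint (H n) (S n))" for n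
      using g by (auto simp: B_def operator_sum_def)
    note adj = complex_hilbert_space.op_adjoint_ip[OF H lin dense gn]
    have "ip ?H (app A f) g = ip ?H f (app B g)" if "f \<in> Dom A" for f
    proof -
      have "f n \<in> Dom (S n)" for n using that by (simp add: A_def operator_sum_def)
      then show ?thesis
        by (simp add: A_def B_def operator_sum_def hilbert_sum_def adj(3))
    qed
    moreover have "g \<in> carr ?H" "app B g \<in> carr ?H"
      using g adj(2) by (simp_all add: B_def operator_sum_def hilbert_sum_def)
    ultimately show ?thesis by blast
  qed
  show "Dom (op_adjoint ?H A) = Dom B"
  proof
    show "Dom (op_adjoint ?H A) \<subseteq> Dom B"
      unfolding op_adjoint_def operator.simps using fwd by blast
    show "Dom B \<subseteq> Dom (op_adjoint ?H A)"
      unfolding op_adjoint_def operator.simps using bwd by blast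
  qed
  show "app (op_adjoint ?H A) f = app B f" if "f \<in> Dom B" for f
    unfolding op_adjoint_def operator.simps
    by (rule the_equality) (use bwd[OF that] fwd in blast)+
qed

section \<open>Boundary triplets and Weyl functions\<close>

definition graph_bounded ::
  "'a inner_space \<Rightarrow> ('a, 'a) operator \<Rightarrow> 'b inner_space \<Rightarrow> ('a, 'b) operator \<Rightarrow> bool" where
  "graph_bounded H T G \<Gamma> \<longleftrightarrow>
     (\<exists>C. \<forall>f\<in>Dom \<Gamma>. hnorm G (app \<Gamma> f) \<le> C * sqrt ((hnorm H f)\<^sup>2 + (hnorm H (app T f))\<^sup>2))"

text \<open>\<open>{G, \<Gamma>0, \<Gamma>1}\<close> is a boundary triplet for the adjoint of \<open>S\<close>. The standing assumptions on
  \<open>S\<close> are part of the notion.\<close>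

locale boundary_triplet = H: complex_hilbert_space H + G: complex_hilbert_space G
  for H :: "'a::complex_vector inner_space"
    and S :: "('a, 'a) operator"
    and G :: "'b::complex_vector inner_space"
    and \<Gamma>0 \<Gamma>1 :: "('a, 'b) operator" +
  assumes linear_S: "linear_operator H H S"
    and dense_S: "densely_defined H S"
    and closed_S: "closed_operator H S"
    and symmetric_S: "symmetric_operator H S"
    and deficiency_S: "equal_deficiency_indices H S"
    and linear_\<Gamma>0: "linear_operator H G \<Gamma>0" and linear_\<Gamma>1: "linear_operator H G \<Gamma>1"
    and Dom_\<Gamma>0: "Dom \<Gamma>0 = Dom (op_adjoint H S)" and Dom_\<Gamma>1: "Dom \<Gamma>1 = Dom (op_adjoint H S)"
    and bounded_\<Gamma>0: "graph_bounded H (op_adjoint H S) G \<Gamma>0"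
    and bounded_\<Gamma>1: "graph_bounded H (op_adjoint H S) G \<Gamma>1"
    and green: "\<lbrakk>f \<in> Dom (op_adjoint H S); g \<in> Dom (op_adjoint H S)\<rbrakk> \<Longrightarrow>
      ip H (app (op_adjoint H S) f) g - ip H f (app (op_adjoint H S) g) =
      ip G (app \<Gamma>1 f) (app \<Gamma>0 g) - ip G (app \<Gamma>0 f) (app \<Gamma>1 g)"
    and surj: "(\<lambda>f. (app \<Gamma>0 f, app \<Gamma>1 f)) ` Dom (op_adjoint H S) = carr G \<times> carr G"

text \<open>The Weyl function at \<open>z\<close>, meant for \<open>z\<close> in the resolvent set of the restriction of the
  adjoint of \<open>S\<close> to the kernel of \<open>\<Gamma>0\<close>. This restriction is self-adjoint for a boundary
  triplet, so every non-real \<open>z\<close> is admissible.\<close>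

definition weyl_function ::
  "'a::complex_vector inner_space \<Rightarrow> ('a, 'a) operator \<Rightarrow> ('a, 'b) operator \<Rightarrow> ('a, 'b) operator \<Rightarrow>
   complex \<Rightarrow> ('b, 'b) operator" where
  "weyl_function H S \<Gamma>0 \<Gamma>1 z =
     op_comp \<Gamma>1 (op_inverse (op_restrict \<Gamma>0 (ker_shift (op_adjoint H S) z)))"

text \<open>The direct sum of the boundary mappings, on its domain inside the domain of the adjoint
  of the direct sum of the \<open>S n\<close>.\<close>

definition boundary_map_sum ::
  "(nat \<Rightarrow> 'a::complex_vector inner_space) \<Rightarrow> (nat \<Rightarrow> ('a, 'a) operator) \<Rightarrow>
   (nat \<Rightarrow> 'b inner_space) \<Rightarrow> (nat \<Rightarrow> ('a, 'b) operator) \<Rightarrow> (nat \<Rightarrow> 'a, nat \<Rightarrow> 'b) operator" where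
  "boundary_map_sum H S G \<Gamma> =
     op_restrict (operator_sum H G \<Gamma>) (Dom (op_adjoint (hilbert_sum H) (operator_sum H H S)))"

end

theory Submission
  imports Defs
begin

text \<open>The direct sum is a boundary triplet exactly when the boundary maps are bounded, uniformly in \<open>n\<close>,
  with respect to the graph norms, and the pairs of boundary maps have uniformly bounded right inverses. With
  the \<open>\<gamma>\<close>-field \<open>\<gamma>(z) = (\<Gamma>0 \<restriction> ker(S\<^sup>* - z))\<inverse>\<close> one has
  \<open>((Im M(\<i>)) g, h) = (\<gamma>(\<i>) g, \<gamma>(\<i>) h)\<close>. A graph norm bound \<open>C\<close> for the boundary maps, applied to
  \<open>\<gamma>(\<i>) g\<close>, therefore bounds \<open>M(\<i>)\<close> and \<open>(Im M(\<i>))\<inverse>\<close> by \<open>2 C\<^sup>2\<close>. Conversely, every \<open>f\<close> in the domain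
  of \<open>S\<^sup>*\<close> is \<open>k + \<gamma>(\<i>) \<Gamma>0 f\<close> with \<open>k\<close> in the domain of the self-adjoint extension \<open>ker \<Gamma>0\<close>, and the bounds
  on \<open>M(\<i>)\<close> and \<open>(Im M(\<i>))\<inverse>\<close> control both summands.\<close>

section \<open>Hilbert spaces and operators\<close>

lemma le_if_power2_le_mult:
  fixes a b :: real
  assumes "a\<^sup>2 \<le> b * a" "0 \<le> a" "0 \<le> b"
  shows "a \<le> b"
  using assms by (cases "a = 0") (simp_all add: power2_eq_square)

lemma tendsto_null_dominated:
  fixes f :: "nat \<Rightarrow> 'b::real_normed_vector"
  assumes "\<And>n. norm (f n) \<le> g n" "g \<longlonglongrightarrow> 0"
  shows "f \<longlonglongrightarrow> 0"
proof (rule tendsto_0_le[OF assms(2), where K = 1], intro always_eventually allI)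
  show "norm (f n) \<le> norm (g n) * 1" for n
    using assms(1)[of n] abs_ge_self[of "g n"] by simp
qed

lemma scaleC_zero_right: "c *\<^sub>C (0::'a::complex_vector) = 0"
  using scaleC_add_right[of c 0 0] by simp

lemma scaleC_diff_right: "c *\<^sub>C (x - y :: 'a::complex_vector) = c *\<^sub>C x - c *\<^sub>C y"
  using scaleC_add_right[of c "x - y" y] by (simp add: algebra_simps)

lemma linear_operatorD:
  assumes "linear_operator H K T"
  shows "0 \<in> Dom T" "\<And>x y. \<lbrakk>x \<in> Dom T; y \<in> Dom T\<rbrakk> \<Longrightarrow> x + y \<in> Dom T"
    and "\<And>c x. x \<in> Dom T \<Longrightarrow> c *\<^sub>C x \<in> Dom T"
    and "\<And>x. x \<in> Dom T \<Longrightarrow> x \<in> carr H" "\<And>x. x \<in> Dom T \<Longrightarrow> app T x \<in> carr K"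
    and "\<And>x y. \<lbrakk>x \<in> Dom T; y \<in> Dom T\<rbrakk> \<Longrightarrow> app T (x + y) = app T x + app T y"
    and "\<And>c x. x \<in> Dom T \<Longrightarrow> app T (c *\<^sub>C x) = c *\<^sub>C app T x"
  using assms unfolding linear_operator_def csubspace_def by blast+

lemma linear_operator_zero: "linear_operator H K T \<Longrightarrow> app T 0 = 0"
  using linear_operatorD(6)[of H K T 0 0] linear_operatorD(1)[of H K T] by simp

lemma linear_operator_restrict:
  assumes T: "linear_operator H K T" and V: "csubspace V"
  shows "linear_operator H K (op_restrict T V)"
  using linear_operatorD[OF T] V
  unfolding linear_operator_def csubspace_def op_restrict_def by auto

context complex_hilbert_space
begin

lemma ip_add_right:
  "\<lbrakk>x \<in> carr H; y \<in> carr H; z \<in> carr H\<rbrakk> \<Longrightarrow> ip H z (x + y) = ip H z x + ip H z y"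
  using ip_cnj[of "x + y" z] ip_cnj[of x z] ip_cnj[of y z]
  by (simp add: ip_add_left carr_add)

lemma ip_scale_right:
  "\<lbrakk>x \<in> carr H; y \<in> carr H\<rbrakk> \<Longrightarrow> ip H x (c *\<^sub>C y) = cnj c * ip H x y"
  using ip_cnj[of "c *\<^sub>C y" x] ip_cnj[of y x] by (simp add: ip_scale_left carr_scale)

lemma hnorm_nonneg: "x \<in> carr H \<Longrightarrow> 0 \<le> hnorm H x"
  by (simp add: hnorm_def ip_nonneg)

lemma hnorm_power2: "x \<in> carr H \<Longrightarrow> (hnorm H x)\<^sup>2 = Re (ip H x x)"
  by (simp add: hnorm_def ip_nonneg)

lemma ip_self: "x \<in> carr H \<Longrightarrow> ip H x x = complex_of_real ((hnorm H x)\<^sup>2)"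
  using ip_cnj[of x x] by (simp add: complex_eq_iff hnorm_power2)

lemma hnorm_eq_0_iff: "x \<in> carr H \<Longrightarrow> hnorm H x = 0 \<longleftrightarrow> x = 0"
  using ip_pos[of x] hnorm_zero by (force simp: hnorm_def)

lemma hnorm_scale: "x \<in> carr H \<Longrightarrow> hnorm H (c *\<^sub>C x) = cmod c * hnorm H x"
proof -
  assume x: "x \<in> carr H"
  have "ip H (c *\<^sub>C x) (c *\<^sub>C x) = (c * cnj c) * ip H x x"
    using x by (simp add: carr_scale ip_scale_left ip_scale_right)
  also have "\<dots> = complex_of_real ((cmod c * hnorm H x)\<^sup>2)"
    unfolding complex_norm_square[symmetric] ip_self[OF x] by (simp add: power_mult_distrib)
  finally have "ip H (c *\<^sub>C x) (c *\<^sub>C x) = complex_of_real ((cmod c * hnorm H x)\<^sup>2)" .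
  then have "(hnorm H (c *\<^sub>C x))\<^sup>2 = (cmod c * hnorm H x)\<^sup>2"
    using x by (simp add: hnorm_power2 carr_scale)
  then show ?thesis by (rule power2_eq_imp_eq) (simp_all add: x hnorm_nonneg carr_scale)
qed

lemma hnorm_minus: "x \<in> carr H \<Longrightarrow> hnorm H (- x) = hnorm H x"
  using hnorm_scale[of x "- 1"] by (simp add: scaleC_minus_one)

lemma hnorm_diff_commute: "\<lbrakk>x \<in> carr H; y \<in> carr H\<rbrakk> \<Longrightarrow> hnorm H (x - y) = hnorm H (y - x)"
  using hnorm_minus[of "x - y"] by (simp add: carr_diff)

lemma hnorm_subtract_projection:
  assumes x: "x \<in> carr H" and y: "y \<in> carr H" "y \<noteq> 0"
  shows "(hnorm H (x - (ip H x y / ip H y y) *\<^sub>C y))\<^sup>2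
    = (hnorm H x)\<^sup>2 - (cmod (ip H x y))\<^sup>2 / (hnorm H y)\<^sup>2"
proof -
  define a where "a = ip H x y"
  have s: "hnorm H y \<noteq> 0" using y by (simp add: hnorm_eq_0_iff)
  have yx: "ip H y x = cnj a" unfolding a_def by (rule ip_cnj[OF x y(1)])
  have yy: "ip H y y \<noteq> 0" "cnj (ip H y y) = ip H y y" using s by (simp_all add: ip_self[OF y(1)])
  have "ip H (x - (a / ip H y y) *\<^sub>C y) (x - (a / ip H y y) *\<^sub>C y)
      = ip H x x - a * cnj a / ip H y y"
    using x y yx yy by (simp add: ip_diff_left ip_diff_right ip_scale_left ip_scale_right
        carr_scale carr_diff a_def[symmetric] field_simps)
  also have "\<dots> = complex_of_real ((hnorm H x)\<^sup>2 - (cmod a)\<^sup>2 / (hnorm H y)\<^sup>2)"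
    unfolding complex_norm_square[symmetric] ip_self[OF x] ip_self[OF y(1)] by simp
  finally show ?thesis
    using x y by (simp add: hnorm_power2 carr_diff carr_scale a_def)
qed

lemma Cauchy_Schwarz:
  assumes x: "x \<in> carr H" and y: "y \<in> carr H"
  shows "cmod (ip H x y) \<le> hnorm H x * hnorm H y"
proof (cases "y = 0")
  case True then show ?thesis using x by (simp add: ip_zero_right hnorm_zero)
next
  case False
  then have s: "hnorm H y > 0" using y hnorm_eq_0_iff hnorm_nonneg by (simp add: order_less_le)
  have "0 \<le> (hnorm H x)\<^sup>2 - (cmod (ip H x y))\<^sup>2 / (hnorm H y)\<^sup>2"
    by (subst hnorm_subtract_projection[OF x y False, symmetric]) simp
  then have "(cmod (ip H x y))\<^sup>2 \<le> (hnorm H x * hnorm H y)\<^sup>2"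
    using s by (simp add: field_simps power_mult_distrib)
  then show ?thesis by (rule power2_le_imp_le) (simp_all add: x y hnorm_nonneg)
qed

lemma hnorm_add_power2:
  "\<lbrakk>x \<in> carr H; y \<in> carr H\<rbrakk> \<Longrightarrow>
    (hnorm H (x + y))\<^sup>2 = (hnorm H x)\<^sup>2 + (hnorm H y)\<^sup>2 + 2 * Re (ip H x y)"
  using ip_cnj[of x y]
  by (simp add: hnorm_power2 ip_add_left ip_add_right carr_add)

lemma hnorm_diff_power2:
  "\<lbrakk>x \<in> carr H; y \<in> carr H\<rbrakk> \<Longrightarrow>
    (hnorm H (x - y))\<^sup>2 = (hnorm H x)\<^sup>2 + (hnorm H y)\<^sup>2 - 2 * Re (ip H x y)"
  using ip_cnj[of x y]
  by (simp add: hnorm_power2 ip_diff_left ip_diff_right carr_diff)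

lemma hnorm_triangle:
  assumes x: "x \<in> carr H" and y: "y \<in> carr H"
  shows "hnorm H (x + y) \<le> hnorm H x + hnorm H y"
proof -
  have "Re (ip H x y) \<le> hnorm H x * hnorm H y"
    using Cauchy_Schwarz[OF x y] complex_Re_le_cmod order_trans by blast
  then have "(hnorm H (x + y))\<^sup>2 \<le> (hnorm H x + hnorm H y)\<^sup>2"
    using x y by (simp add: hnorm_add_power2 power2_sum)
  then show ?thesis by (rule power2_le_imp_le) (simp_all add: x y hnorm_nonneg)
qed

lemma hnorm_triangle_diff:
  "\<lbrakk>x \<in> carr H; y \<in> carr H\<rbrakk> \<Longrightarrow> hnorm H (x - y) \<le> hnorm H x + hnorm H y"
  using hnorm_triangle[of x "- y"] by (simp add: carr_minus hnorm_minus)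

lemma hnorm_triangle_mid:
  "\<lbrakk>x \<in> carr H; y \<in> carr H; z \<in> carr H\<rbrakk> \<Longrightarrow> hnorm H (x - z) \<le> hnorm H (x - y) + hnorm H (y - z)"
  using hnorm_triangle[of "x - y" "y - z"] by (simp add: carr_diff)

lemma parallelogram_law:
  "\<lbrakk>x \<in> carr H; y \<in> carr H\<rbrakk> \<Longrightarrow>
    (hnorm H (x + y))\<^sup>2 + (hnorm H (x - y))\<^sup>2 = 2 * (hnorm H x)\<^sup>2 + 2 * (hnorm H y)\<^sup>2"
  by (simp add: hnorm_add_power2 hnorm_diff_power2)

lemma hnorm_add_power2_le:
  assumes "x \<in> carr H" "y \<in> carr H"
  shows "(hnorm H (x + y))\<^sup>2 \<le> 2 * (hnorm H x)\<^sup>2 + 2 * (hnorm H y)\<^sup>2"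
  using parallelogram_law[OF assms] zero_le_power2[of "hnorm H (x - y)"] by linarith

lemma tendsto_ip_left:
  assumes X: "\<And>n. X n \<in> carr H" and x: "x \<in> carr H" and z: "z \<in> carr H"
    and lim: "(\<lambda>n. hnorm H (X n - x)) \<longlonglongrightarrow> 0"
  shows "(\<lambda>n. ip H (X n) z) \<longlonglongrightarrow> ip H x z"
proof (rule LIM_zero_cancel, rule tendsto_null_dominated)
  show "cmod (ip H (X n) z - ip H x z) \<le> hnorm H (X n - x) * hnorm H z" for n
    using Cauchy_Schwarz[OF carr_diff[OF X x] z] X x z by (simp add: ip_diff_left)
  show "(\<lambda>n. hnorm H (X n - x) * hnorm H z) \<longlonglongrightarrow> 0"
    using tendsto_mult_right[OF lim, of "hnorm H z"] by simp
qed

lemma tendsto_ip_right: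
  assumes X: "\<And>n. X n \<in> carr H" and x: "x \<in> carr H" and z: "z \<in> carr H"
    and lim: "(\<lambda>n. hnorm H (X n - x)) \<longlonglongrightarrow> 0"
  shows "(\<lambda>n. ip H z (X n)) \<longlonglongrightarrow> ip H z x"
  using tendsto_cnj[OF tendsto_ip_left[OF X x z lim]] ip_cnj[OF X z] ip_cnj[OF x z] by simp

lemma tendsto_hnorm_diff:
  assumes X: "\<And>n. X n \<in> carr H" and x: "x \<in> carr H" and z: "z \<in> carr H"
    and lim: "(\<lambda>n. hnorm H (X n - x)) \<longlonglongrightarrow> 0"
  shows "(\<lambda>n. hnorm H (z - X n)) \<longlonglongrightarrow> hnorm H (z - x)"
proof (rule LIM_zero_cancel, rule tendsto_null_dominated[OF _ lim])
  fix n
  have "hnorm H (z - X n) \<le> hnorm H (z - x) + hnorm H (X n - x)"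
    using hnorm_triangle_mid[OF z x X[of n]] hnorm_diff_commute[OF x X[of n]] by simp
  moreover have "hnorm H (z - x) \<le> hnorm H (z - X n) + hnorm H (X n - x)"
    by (rule hnorm_triangle_mid[OF z X x])
  ultimately show "norm (hnorm H (z - X n) - hnorm H (z - x)) \<le> hnorm H (X n - x)"
    by (simp add: abs_le_iff)
qed

lemma tendsto_add_hnorm:
  assumes "\<And>n. X n \<in> carr H" "x \<in> carr H" "\<And>n. Y n \<in> carr H" "y \<in> carr H"
    and "(\<lambda>n. hnorm H (X n - x)) \<longlonglongrightarrow> 0" "(\<lambda>n. hnorm H (Y n - y)) \<longlonglongrightarrow> 0"
  shows "(\<lambda>n. hnorm H (X n + Y n - (x + y))) \<longlonglongrightarrow> 0"
proof (rule tendsto_null_dominated)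
  show "norm (hnorm H (X n + Y n - (x + y))) \<le> hnorm H (X n - x) + hnorm H (Y n - y)" for n
    using hnorm_triangle[of "X n - x" "Y n - y"] assms(1-4)
    by (simp add: carr_diff carr_add hnorm_nonneg add_diff_add)
  show "(\<lambda>n. hnorm H (X n - x) + hnorm H (Y n - y)) \<longlonglongrightarrow> 0"
    using tendsto_add[OF assms(5,6)] by simp
qed

lemma tendsto_scale_hnorm:
  assumes "\<And>n. X n \<in> carr H" "x \<in> carr H" "(\<lambda>n. hnorm H (X n - x)) \<longlonglongrightarrow> 0"
  shows "(\<lambda>n. hnorm H (c *\<^sub>C X n - c *\<^sub>C x)) \<longlonglongrightarrow> 0"
proof -
  have "c *\<^sub>C X n - c *\<^sub>C x = c *\<^sub>C (X n - x)" for n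
    by (simp add: scaleC_diff_right)
  then have "(\<lambda>n. hnorm H (c *\<^sub>C X n - c *\<^sub>C x)) = (\<lambda>n. cmod c * hnorm H (X n - x))"
    using assms by (simp add: hnorm_scale carr_diff)
  then show ?thesis using tendsto_mult_left[OF assms(3), of "cmod c"] by simp
qed

lemma eq_if_ip_eq:
  assumes "x \<in> carr H" "y \<in> carr H" "\<And>z. z \<in> carr H \<Longrightarrow> ip H x z = ip H y z"
  shows "x = y"
proof -
  have "ip H (x - y) (x - y) = 0" using assms by (simp add: ip_diff_left carr_diff)
  then show ?thesis using assms hnorm_eq_0_iff[of "x - y"] by (simp add: hnorm_def carr_diff)
qed

lemma closed_subspace_eq_carr:
  assumes V: "csubspace V" "V \<subseteq> carr H"
    and closed: "\<And>X x. \<lbrakk>\<And>n::nat. X n \<in> V; x \<in> carr H; (\<lambda>n. hnorm H (X n - x)) \<longlonglongrightarrow> 0\<rbrakk> \<Longrightarrow> x \<in> V"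
    and orth: "\<And>y. \<lbrakk>y \<in> carr H; \<And>v. v \<in> V \<Longrightarrow> ip H v y = 0\<rbrakk> \<Longrightarrow> y = 0"
  shows "V = carr H"
proof (rule equalityI[OF V(2)], rule subsetI)
  fix x assume x: "x \<in> carr H"
  have Vc: "v \<in> carr H" if "v \<in> V" for v using that V(2) by blast
  have Vlin: "0 \<in> V" "\<And>v w. v \<in> V \<Longrightarrow> w \<in> V \<Longrightarrow> v + w \<in> V" "\<And>c v. v \<in> V \<Longrightarrow> c *\<^sub>C v \<in> V"
    using V(1) by (auto simp: csubspace_def)
  define d where "d = (INF v\<in>V. (hnorm H (x - v))\<^sup>2)"
  have bdd: "bdd_below ((\<lambda>v. (hnorm H (x - v))\<^sup>2) ` V)"
    by (rule bdd_belowI[of _ 0]) auto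
  have d_le: "d \<le> (hnorm H (x - v))\<^sup>2" if "v \<in> V" for v
    unfolding d_def using bdd that by (rule cINF_lower)
  have "\<exists>v\<in>V. (hnorm H (x - v))\<^sup>2 < d + 1 / real (Suc n)" for n
    using cINF_less_iff[of V "\<lambda>v. (hnorm H (x - v))\<^sup>2" "d + 1 / real (Suc n)"] bdd Vlin(1)
    by (auto simp: d_def)
  then obtain X where X: "\<And>n. X n \<in> V"
    and Xd: "\<And>n. (hnorm H (x - X n))\<^sup>2 < d + 1 / real (Suc n)" by metis
  have parallelogram: "(hnorm H (X m - X n))\<^sup>2 \<le> 2 / real (Suc m) + 2 / real (Suc n)" for m n
  proof -
    let ?a = "x - X m" and ?b = "x - X n" and ?w = "(1/2) *\<^sub>C (X m + X n)"
    have c: "?a \<in> carr H" "?b \<in> carr H" "?w \<in> carr H" "?w \<in> V"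
      using x X Vc Vlin by (auto intro!: carr_diff)
    have half: "(1/2) *\<^sub>C x + (1/2) *\<^sub>C x = x"
      using scaleC_add_left[of "1/2" "1/2" x] by (simp add: scaleC_one)
    have "x - ?w = (1/2) *\<^sub>C (?a + ?b)"
    proof -
      have "(1/2) *\<^sub>C (?a + ?b) + ?w = (1/2) *\<^sub>C (x + x)"
        by (simp add: scaleC_add_right[symmetric])
      also have "\<dots> = x" using half by (simp add: scaleC_add_right)
      finally show ?thesis by (simp add: algebra_simps)
    qed
    then have "hnorm H (?a + ?b) = 2 * hnorm H (x - ?w)" using c by (simp add: hnorm_scale carr_add)
    then have "(hnorm H (?a + ?b))\<^sup>2 \<ge> 4 * d" using d_le[OF c(4)] by (simp add: power_mult_distrib)
    moreover have "(hnorm H (?a + ?b))\<^sup>2 + (hnorm H (X m - X n))\<^sup>2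
        = 2 * (hnorm H ?a)\<^sup>2 + 2 * (hnorm H ?b)\<^sup>2"
      using parallelogram_law[OF c(1,2)] hnorm_diff_commute[OF Vc[OF X] Vc[OF X], of m n] by simp
    ultimately show ?thesis using Xd[of m] Xd[of n] by simp
  qed
  have "\<exists>v\<in>carr H. (\<lambda>n. hnorm H (X n - v)) \<longlonglongrightarrow> 0"
  proof (rule complete)
    show "X n \<in> carr H" for n using X Vc by blast
    show "\<forall>e>0. \<exists>N. \<forall>m\<ge>N. \<forall>n\<ge>N. hnorm H (X m - X n) < e"
    proof (intro allI impI)
      fix e :: real assume e: "e > 0"
      obtain N where N: "1 / real (Suc N) < e\<^sup>2 / 4"
        using nat_approx_posE[of "e\<^sup>2 / 4"] e by auto
      have "hnorm H (X m - X n) < e" if "m \<ge> N" "n \<ge> N" for m n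
      proof -
        have "1 / real (Suc m) \<le> 1 / real (Suc N)" "1 / real (Suc n) \<le> 1 / real (Suc N)"
          using that by (auto intro!: divide_left_mono)
        then have "(hnorm H (X m - X n))\<^sup>2 < e\<^sup>2" using parallelogram[of m n] N by simp
        then show ?thesis using e by (simp add: power2_less_imp_less)
      qed
      then show "\<exists>N. \<forall>m\<ge>N. \<forall>n\<ge>N. hnorm H (X m - X n) < e" by blast
    qed
  qed
  then obtain v where v: "v \<in> carr H" "(\<lambda>n. hnorm H (X n - v)) \<longlonglongrightarrow> 0" by blast
  have vV: "v \<in> V" using closed[OF X v] .
  have "(\<lambda>n. (hnorm H (x - X n))\<^sup>2) \<longlonglongrightarrow> (hnorm H (x - v))\<^sup>2"
    using tendsto_power[OF tendsto_hnorm_diff[OF Vc[OF X] v(1) x v(2)]] .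
  moreover have "(\<lambda>n. d + 1 / real (Suc n)) \<longlonglongrightarrow> d"
    using tendsto_add[OF tendsto_const LIMSEQ_Suc[OF lim_1_over_n], of d] by simp
  ultimately have le: "(hnorm H (x - v))\<^sup>2 \<le> d"
    using Xd by (intro LIMSEQ_le) (auto intro: less_imp_le)
  have "ip H (x - v) u = 0" if u: "u \<in> V" for u
  proof (cases "u = 0")
    case True then show ?thesis using x v by (simp add: ip_zero_right carr_diff)
  next
    case False
    let ?c = "ip H (x - v) u / ip H u u"
    have "d \<le> (hnorm H (x - (v + ?c *\<^sub>C u)))\<^sup>2" using d_le vV u Vlin by blast
    then have "d \<le> (hnorm H (x - v))\<^sup>2 - (cmod (ip H (x - v) u))\<^sup>2 / (hnorm H u)\<^sup>2"
      using hnorm_subtract_projection[OF carr_diff[OF x v(1)] Vc[OF u] False]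
      by (simp add: diff_diff_eq)
    then have "(cmod (ip H (x - v) u))\<^sup>2 / (hnorm H u)\<^sup>2 \<le> 0" using le by simp
    then show ?thesis
      using False hnorm_eq_0_iff[OF Vc[OF u]] by (simp add: divide_le_0_iff)
  qed
  then have "ip H u (x - v) = 0" if "u \<in> V" for u
    using ip_cnj[OF carr_diff[OF x v(1)] Vc[OF that]] that by simp
  then have "x - v = 0" using orth[OF carr_diff[OF x v(1)]] by blast
  then show "x \<in> V" using vV by simp
qed

lemma linear_operator_diff:
  assumes T: "linear_operator K L T" and "x \<in> Dom T" "y \<in> Dom T"
  shows "x - y \<in> Dom T" "app T (x - y) = app T x - app T y"
proof -
  have "- y \<in> Dom T" "app T (- y) = - app T y"
    using linear_operatorD(3,7)[OF T assms(3), of "- 1"] by (simp_all add: scaleC_minus_one)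
  then show "x - y \<in> Dom T" "app T (x - y) = app T x - app T y"
    using linear_operatorD(2,6)[OF T assms(2), of "- y"] by simp_all
qed

lemma closed_bounded_below_range:
  assumes T: "linear_operator H H T" and closed: "closed_operator H T"
    and c: "c > 0" and below: "\<And>x. x \<in> Dom T \<Longrightarrow> c * hnorm H x \<le> hnorm H (app T x)"
    and orth: "\<And>y. \<lbrakk>y \<in> carr H; \<And>x. x \<in> Dom T \<Longrightarrow> ip H (app T x) y = 0\<rbrakk> \<Longrightarrow> y = 0"
  shows "app T ` Dom T = carr H"
proof (rule closed_subspace_eq_carr)
  have D: "x \<in> carr H" "app T x \<in> carr H" if "x \<in> Dom T" for x
    using T that by (auto simp: linear_operator_def)
  show "csubspace (app T ` Dom T)"
    unfolding csubspace_def
  proof (intro conjI ballI allI)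
    show "0 \<in> app T ` Dom T"
      using linear_operatorD(1)[OF T] linear_operator_zero[OF T] by force
    show "x + y \<in> app T ` Dom T" if "x \<in> app T ` Dom T" "y \<in> app T ` Dom T" for x y
      using that
    proof (elim imageE)
      fix u v assume "x = app T u" "u \<in> Dom T" "y = app T v" "v \<in> Dom T"
      then show ?thesis using linear_operatorD(2,6)[OF T, of u v] by (metis image_eqI)
    qed
    show "k *\<^sub>C x \<in> app T ` Dom T" if "x \<in> app T ` Dom T" for k x
      using that
    proof (elim imageE)
      fix u assume "x = app T u" "u \<in> Dom T"
      then show ?thesis using linear_operatorD(3,7)[OF T, of u k] by (metis image_eqI)
    qed
  qed
  show "app T ` Dom T \<subseteq> carr H" using D by blast
  show "y = 0" if "y \<in> carr H" "\<And>v. v \<in> app T ` Dom T \<Longrightarrow> ip H v y = 0" for y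
    using orth that by blast
  fix Y y assume Y: "\<And>n::nat. Y n \<in> app T ` Dom T" and y: "y \<in> carr H"
    and lim: "(\<lambda>n. hnorm H (Y n - y)) \<longlonglongrightarrow> 0"
  have "\<forall>n. \<exists>x. x \<in> Dom T \<and> Y n = app T x" using Y by blast
  then obtain X where X: "\<And>n. X n \<in> Dom T" "\<And>n. Y n = app T (X n)" by metis
  have Yc: "Y n \<in> carr H" for n using X D by simp
  have XY: "c * hnorm H (X m - X n) \<le> hnorm H (Y m - y) + hnorm H (Y n - y)" for m n
  proof -
    have "c * hnorm H (X m - X n) \<le> hnorm H (Y m - Y n)"
      using below[of "X m - X n"] linear_operator_diff[OF T X(1)[of m] X(1)[of n]] X(2) by simp
    also have "\<dots> \<le> hnorm H (Y m - y) + hnorm H (Y n - y)"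
      using hnorm_triangle_mid[OF Yc y Yc, of m n] hnorm_diff_commute[OF y Yc, of n] by simp
    finally show ?thesis .
  qed
  have "\<exists>x\<in>carr H. (\<lambda>n. hnorm H (X n - x)) \<longlonglongrightarrow> 0"
  proof (rule complete)
    show "X n \<in> carr H" for n using X D by blast
    show "\<forall>e>0. \<exists>N. \<forall>m\<ge>N. \<forall>n\<ge>N. hnorm H (X m - X n) < e"
    proof (intro allI impI)
      fix e :: real assume e: "e > 0"
      then have "e * c / 2 > 0" using c by simp
      from LIMSEQ_D[OF lim this]
      obtain N where "\<And>n. n \<ge> N \<Longrightarrow> norm (hnorm H (Y n - y) - 0) < e * c / 2" by blast
      then have N: "hnorm H (Y n - y) < e * c / 2" if "n \<ge> N" for n
        using that abs_ge_self[of "hnorm H (Y n - y)"] by fastforce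
      have "hnorm H (X m - X n) < e" if "m \<ge> N" "n \<ge> N" for m n
      proof -
        have "c * hnorm H (X m - X n) < c * e"
          using XY[of m n] N[OF that(1)] N[OF that(2)] by argo
        then show ?thesis using mult_less_cancel_left_pos[OF c] by blast
      qed
      then show "\<exists>N. \<forall>m\<ge>N. \<forall>n\<ge>N. hnorm H (X m - X n) < e" by blast
    qed
  qed
  then obtain x where x: "x \<in> carr H" "(\<lambda>n. hnorm H (X n - x)) \<longlonglongrightarrow> 0" by blast
  have "(\<lambda>n. hnorm H (app T (X n) - y)) \<longlonglongrightarrow> 0" using lim X(2) by simp
  then have "x \<in> Dom T \<and> app T x = y"
    using closed[unfolded closed_operator_def, rule_format, OF x(1) y] x(2) X(1) by blast
  then show "y \<in> app T ` Dom T" by blast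
qed

end

lemma op_norm_le_iff:
  assumes H: "complex_hilbert_space H" and K: "complex_hilbert_space K"
    and T: "linear_operator H K T" and C: "C \<ge> 0"
  shows "op_norm H K T \<le> ennreal C \<longleftrightarrow> (\<forall>x\<in>Dom T. hnorm K (app T x) \<le> C * hnorm H x)"
proof -
  interpret H: complex_hilbert_space H by fact
  interpret K: complex_hilbert_space K by fact
  note TD = linear_operatorD[OF T]
  show ?thesis
  proof
    assume le: "op_norm H K T \<le> ennreal C"
    show "\<forall>x\<in>Dom T. hnorm K (app T x) \<le> C * hnorm H x"
    proof
      fix x assume x: "x \<in> Dom T"
      show "hnorm K (app T x) \<le> C * hnorm H x"
      proof (cases "x = 0")
        case True
        then show ?thesis using linear_operator_zero[OF T] by (simp add: K.hnorm_zero H.hnorm_zero)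
      next
        case False
        then have pos: "hnorm H x > 0"
          using H.hnorm_eq_0_iff[OF TD(4)[OF x]] H.hnorm_nonneg[OF TD(4)[OF x]] by simp
        define c where "c = complex_of_real (1 / hnorm H x)"
        have "hnorm H (c *\<^sub>C x) = 1"
          using pos by (simp add: H.hnorm_scale TD(4) x c_def norm_divide)
        then have "ennreal (hnorm K (app T (c *\<^sub>C x))) \<le> op_norm H K T"
          unfolding op_norm_def by (intro SUP_upper) (use TD(3) x in simp)
        then have "hnorm K (app T (c *\<^sub>C x)) \<le> C"
          using le C by (metis ennreal_le_iff order_trans)
        then show ?thesis
          using pos by (simp add: TD(7) x K.hnorm_scale TD(5) c_def norm_divide field_simps)
      qed
    qed
  next
    assume le: "\<forall>x\<in>Dom T. hnorm K (app T x) \<le> C * hnorm H x"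
    show "op_norm H K T \<le> ennreal C"
      unfolding op_norm_def
    proof (rule SUP_least)
      fix x assume "x \<in> {x \<in> Dom T. hnorm H x \<le> 1}"
      then have x: "x \<in> Dom T" "hnorm H x \<le> 1" by auto
      have "hnorm K (app T x) \<le> C * hnorm H x" using le x by blast
      also have "\<dots> \<le> C" using mult_left_mono[OF x(2) C] by simp
      finally show "ennreal (hnorm K (app T x)) \<le> ennreal C" by (rule ennreal_leI)
    qed
  qed
qed

lemma SUP_op_norm_finite_iff:
  assumes "\<And>n. complex_hilbert_space (H n)" "\<And>n. complex_hilbert_space (K n)"
    and "\<And>n. linear_operator (H n) (K n) (T n)"
  shows "(SUP n. op_norm (H n) (K n) (T n)) < \<infinity> \<longleftrightarrow>
    (\<exists>C\<ge>0. \<forall>n. \<forall>x\<in>Dom (T n). hnorm (K n) (app (T n) x) \<le> C * hnorm (H n) x)"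
    (is "?S < \<infinity> \<longleftrightarrow> ?R")
proof
  assume "?S < \<infinity>"
  then obtain C where C: "C \<ge> 0" "?S = ennreal C" by (cases ?S) auto
  have "op_norm (H n) (K n) (T n) \<le> ennreal C" for n
    unfolding C(2)[symmetric] by (rule SUP_upper) simp
  then show ?R using op_norm_le_iff[OF assms C(1)] C(1) by blast
next
  assume ?R
  then obtain C where C: "C \<ge> 0"
    "\<And>n. \<forall>x\<in>Dom (T n). hnorm (K n) (app (T n) x) \<le> C * hnorm (H n) x" by blast
  have "?S \<le> ennreal C"
    by (rule SUP_least) (use op_norm_le_iff[OF assms C(1)] C(2) in blast)
  also have "\<dots> < \<infinity>" by simp
  finally show "?S < \<infinity>" .
qed

lemma linear_operator_inverse:
  assumes T: "linear_operator H K T" and inj: "inj_on (app T) (Dom T)"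
  shows "linear_operator K H (op_inverse T)"
proof -
  note TD = linear_operatorD[OF T]
  have inv: "inv_into (Dom T) (app T) (app T x) = x" if "x \<in> Dom T" for x
    using inv_into_f_f[OF inj that] .
  have dom: "Dom (op_inverse T) = app T ` Dom T" by (simp add: op_inverse_def)
  have val: "app (op_inverse T) (app T x) = x" if "x \<in> Dom T" for x
    using inv[OF that] by (simp add: op_inverse_def)
  have add: "u + v \<in> Dom (op_inverse T) \<and>
      app (op_inverse T) (u + v) = app (op_inverse T) u + app (op_inverse T) v"
    if uv: "u \<in> Dom (op_inverse T)" "v \<in> Dom (op_inverse T)" for u v
  proof -
    obtain x y where xy: "x \<in> Dom T" "y \<in> Dom T" "u = app T x" "v = app T y"
      using uv unfolding dom by blast
    then show ?thesis
      using TD(2,6)[OF xy(1,2)] val by (metis dom image_eqI)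
  qed
  have scale: "c *\<^sub>C u \<in> Dom (op_inverse T) \<and>
      app (op_inverse T) (c *\<^sub>C u) = c *\<^sub>C app (op_inverse T) u"
    if u: "u \<in> Dom (op_inverse T)" for c u
  proof -
    obtain x where x: "x \<in> Dom T" "u = app T x" using u unfolding dom by blast
    then show ?thesis using TD(3,7)[OF x(1), of c] val by (metis dom image_eqI)
  qed
  have "0 \<in> Dom (op_inverse T)"
    unfolding dom using TD(1) linear_operator_zero[OF T] by (metis image_eqI)
  moreover have "Dom (op_inverse T) \<subseteq> carr K" "app (op_inverse T) ` Dom (op_inverse T) \<subseteq> carr H"
    unfolding dom using TD(4,5) val by auto
  ultimately show ?thesis
    unfolding linear_operator_def csubspace_def using add scale by blast
qed

section \<open>The Weyl function of a boundary triplet\<close>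

context boundary_triplet
begin

abbreviation T where "T \<equiv> op_adjoint H S"

lemmas adjoint_app = H.op_adjoint_app[OF linear_S dense_S]
lemmas adjoint_ip = H.op_adjoint_ip[OF linear_S dense_S]

lemma linear_T: "linear_operator H H T"
proof -
  note SD = linear_operatorD[OF linear_S]
  have zero: "0 \<in> Dom T"
    by (rule adjoint_app(1)[of 0 0]) (simp_all add: H.carr_zero H.ip_zero_right SD)
  have add: "x + y \<in> Dom T \<and> app T (x + y) = app T x + app T y"
    if x: "x \<in> Dom T" and y: "y \<in> Dom T" for x y
  proof -
    note c = adjoint_ip(1,2)[OF x] adjoint_ip(1,2)[OF y]
    have "ip H (app S f) (x + y) = ip H f (app T x + app T y)" if f: "f \<in> Dom S" for f
      using c SD(4,5)[OF f] adjoint_ip(3)[OF x f] adjoint_ip(3)[OF y f]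
      by (simp add: H.ip_add_right)
    then show ?thesis
      using adjoint_app[OF H.carr_add[OF c(1,3)] H.carr_add[OF c(2,4)]] by blast
  qed
  have scale: "c *\<^sub>C x \<in> Dom T \<and> app T (c *\<^sub>C x) = c *\<^sub>C app T x"
    if x: "x \<in> Dom T" for c x
  proof -
    note d = adjoint_ip(1,2)[OF x]
    have "ip H (app S f) (c *\<^sub>C x) = ip H f (c *\<^sub>C app T x)" if f: "f \<in> Dom S" for f
      using d SD(4,5)[OF f] adjoint_ip(3)[OF x f] by (simp add: H.ip_scale_right)
    then show ?thesis
      using adjoint_app[OF H.carr_scale[OF d(1)] H.carr_scale[OF d(2)]] by blast
  qed
  show ?thesis
    unfolding linear_operator_def csubspace_def using zero add scale adjoint_ip by blast
qed

lemmas TD = linear_operatorD[OF linear_T]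
lemmas T_diff = H.linear_operator_diff[OF linear_T]

lemma Gamma_carr: "f \<in> Dom T \<Longrightarrow> app \<Gamma>0 f \<in> carr G" "f \<in> Dom T \<Longrightarrow> app \<Gamma>1 f \<in> carr G"
  using linear_operatorD(5)[OF linear_\<Gamma>0] linear_operatorD(5)[OF linear_\<Gamma>1]
  by (simp_all add: Dom_\<Gamma>0 Dom_\<Gamma>1)

lemmas Gamma_linear =
  linear_operatorD(6,7)[OF linear_\<Gamma>0, unfolded Dom_\<Gamma>0]
  linear_operatorD(6,7)[OF linear_\<Gamma>1, unfolded Dom_\<Gamma>1]
  H.linear_operator_diff(2)[OF linear_\<Gamma>0, unfolded Dom_\<Gamma>0]
  H.linear_operator_diff(2)[OF linear_\<Gamma>1, unfolded Dom_\<Gamma>1]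

lemma boundary_valuesE:
  assumes "g \<in> carr G" "h \<in> carr G"
  obtains f where "f \<in> Dom T" "app \<Gamma>0 f = g" "app \<Gamma>1 f = h"
proof -
  have "(g, h) \<in> (\<lambda>f. (app \<Gamma>0 f, app \<Gamma>1 f)) ` Dom T" using assms surj by simp
  then show ?thesis using that by auto
qed

lemma closed_T: "closed_operator H T"
  unfolding closed_operator_def
proof (intro allI ballI impI, elim conjE)
  fix X x y
  assume x: "x \<in> carr H" and y: "y \<in> carr H" and X: "\<forall>n::nat. X n \<in> Dom T"
    and lim: "(\<lambda>n. hnorm H (X n - x)) \<longlonglongrightarrow> 0" "(\<lambda>n. hnorm H (app T (X n) - y)) \<longlonglongrightarrow> 0"
  note SD = linear_operatorD[OF linear_S]
  have "ip H (app S f) x = ip H f y" if f: "f \<in> Dom S" for f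
  proof (rule LIMSEQ_unique)
    show "(\<lambda>n. ip H (app S f) (X n)) \<longlonglongrightarrow> ip H (app S f) x"
      using H.tendsto_ip_right[of X x "app S f"] X x lim(1) SD(5)[OF f] TD(4) by blast
    show "(\<lambda>n. ip H (app S f) (X n)) \<longlonglongrightarrow> ip H f y"
      using H.tendsto_ip_right[of "\<lambda>n. app T (X n)" y f] X y lim(2) SD(4)[OF f] TD(5)
        adjoint_ip(3)[OF _ f] by simp
  qed
  then show "x \<in> Dom T \<and> app T x = y" using adjoint_app[OF x y] by blast
qed

text \<open>The restriction of \<open>T\<close> to the kernel of \<open>\<Gamma>0\<close> contains its adjoint, because \<open>\<Gamma>1\<close> maps this kernel
  onto \<open>G\<close>.\<close>

lemma Gamma0_eq_0I:
  assumes f: "f \<in> Dom T"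
    and sym: "\<And>k. \<lbrakk>k \<in> Dom T; app \<Gamma>0 k = 0\<rbrakk> \<Longrightarrow> ip H (app T k) f = ip H k (app T f)"
  shows "app \<Gamma>0 f = 0"
proof -
  obtain k where k: "k \<in> Dom T" "app \<Gamma>0 k = 0" "app \<Gamma>1 k = app \<Gamma>0 f"
    using boundary_valuesE[OF G.carr_zero Gamma_carr(1)[OF f]] by metis
  have "ip G (app \<Gamma>0 f) (app \<Gamma>0 f) = 0"
    using green[OF k(1) f] sym[OF k(1,2)] by (simp add: k G.ip_zero_left Gamma_carr f)
  then show ?thesis
    using G.hnorm_eq_0_iff[OF Gamma_carr(1)[OF f]] by (simp add: hnorm_def)
qed

lemma S_extension:
  assumes f: "f \<in> Dom S"
  shows "f \<in> Dom T" "app T f = app S f" "app \<Gamma>0 f = 0"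
proof -
  note SD = linear_operatorD[OF linear_S]
  have sym: "ip H (app S g) f = ip H g (app S f)" if "g \<in> Dom S" for g
    using symmetric_S that f by (simp add: symmetric_operator_def)
  show fT: "f \<in> Dom T" and Tf: "app T f = app S f"
    using adjoint_app[OF SD(4)[OF f] SD(5)[OF f] sym] by blast+
  show "app \<Gamma>0 f = 0"
  proof (rule Gamma0_eq_0I[OF fT])
    fix k assume k: "k \<in> Dom T"
    have "ip H k (app S f) = cnj (ip H (app S f) k)"
      by (rule H.ip_cnj[OF SD(5)[OF f] TD(4)[OF k]])
    also have "\<dots> = cnj (ip H f (app T k))" using adjoint_ip(3)[OF k f] by simp
    also have "\<dots> = ip H (app T k) f" by (rule H.ip_cnj[OF TD(4)[OF fT] TD(5)[OF k], symmetric])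
    finally show "ip H (app T k) f = ip H k (app T f)" using Tf by simp
  qed
qed

lemma hnorm_shift_ge:
  assumes f: "f \<in> Dom T" "app \<Gamma>0 f = 0"
  shows "\<bar>Im z\<bar> * hnorm H f \<le> hnorm H (app T f - z *\<^sub>C f)"
proof (cases "hnorm H f = 0")
  case True
  then show ?thesis using f by (simp add: H.hnorm_nonneg H.carr_diff H.carr_scale TD)
next
  case False
  have fc: "f \<in> carr H" "app T f \<in> carr H" using TD f by auto
  then have pos: "hnorm H f > 0" using False H.hnorm_nonneg[of f] by simp
  have "ip H (app T f) f = cnj (ip H (app T f) f)"
    using green[OF f(1) f(1)] H.ip_cnj[OF fc(2) fc(1)]
    by (simp add: f(2) G.ip_zero_left G.ip_zero_right Gamma_carr f(1))
  then have "Im (ip H (app T f) f) = 0"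
    by (metis complex_cnj_cancel_iff complex.sel(2) cnj.simps(2) equal_neg_zero)
  then have "Im (ip H (app T f - z *\<^sub>C f) f) = - Im z * (hnorm H f)\<^sup>2"
    using fc by (simp add: H.ip_diff_left H.carr_scale H.ip_scale_left H.ip_self)
  then have "\<bar>Im z\<bar> * (hnorm H f)\<^sup>2 = \<bar>Im (ip H (app T f - z *\<^sub>C f) f)\<bar>"
    by (simp add: abs_mult)
  also have "\<dots> \<le> hnorm H (app T f - z *\<^sub>C f) * hnorm H f"
    using H.Cauchy_Schwarz[of "app T f - z *\<^sub>C f" f] fc abs_Im_le_cmod order_trans
    by (metis H.carr_diff H.carr_scale)
  finally show ?thesis using pos by (simp add: power2_eq_square)
qed

text \<open>The self-adjoint extension \<open>ker \<Gamma>0\<close> has no non-real spectrum.\<close>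

lemma shift_onto:
  assumes z: "Im z \<noteq> 0" and h: "h \<in> carr H"
  obtains f where "f \<in> Dom T" "app \<Gamma>0 f = 0" "app T f - z *\<^sub>C f = h"
proof -
  define A where "A = \<lparr>Dom = {f \<in> Dom T. app \<Gamma>0 f = 0}, app = (\<lambda>f. app T f - z *\<^sub>C f)\<rparr>"
  have "app A ` Dom A = carr H"
  proof (rule H.closed_bounded_below_range)
    show "linear_operator H H A"
      unfolding linear_operator_def csubspace_def
    proof (intro conjI ballI allI subsetI)
      show "0 \<in> Dom A" using TD(1) linear_operator_zero[OF linear_\<Gamma>0] by (simp add: A_def)
      show "x \<in> carr H" if "x \<in> Dom A" for x using that TD(4) by (simp add: A_def)
      show "h \<in> carr H" if "h \<in> app A ` Dom A" for h
        using that TD(4,5) by (auto simp: A_def H.carr_diff H.carr_scale)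
      fix x assume x: "x \<in> Dom A"
      then show "c *\<^sub>C x \<in> Dom A" for c
        by (simp add: A_def TD(3) Gamma_linear scaleC_zero_right)
      show "app A (c *\<^sub>C x) = c *\<^sub>C app A x" for c
        using x scaleC_add_right[of c "app T x - z *\<^sub>C x" "z *\<^sub>C x"]
        by (simp add: A_def TD(7) scaleC_scaleC mult.commute)
      fix y assume y: "y \<in> Dom A"
      then show "x + y \<in> Dom A" "app A (x + y) = app A x + app A y"
        using x by (simp_all add: A_def TD(2,6) Gamma_linear scaleC_add_right)
    qed
    show "0 < \<bar>Im z\<bar>" using z by simp
    show "\<bar>Im z\<bar> * hnorm H x \<le> hnorm H (app A x)" if "x \<in> Dom A" for x
      using that hnorm_shift_ge by (simp add: A_def)
    show "closed_operator H A"
      unfolding closed_operator_def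
    proof (intro allI ballI impI, elim conjE)
      fix X x y
      assume x: "x \<in> carr H" and y: "y \<in> carr H" and X: "\<forall>n::nat. X n \<in> Dom A"
        and lim: "(\<lambda>n. hnorm H (X n - x)) \<longlonglongrightarrow> 0" "(\<lambda>n. hnorm H (app A (X n) - y)) \<longlonglongrightarrow> 0"
      have X': "X n \<in> Dom T" "app \<Gamma>0 (X n) = 0" for n using X by (auto simp: A_def)
      have Xc: "X n \<in> carr H" "app T (X n) \<in> carr H" for n using X' TD by auto
      define y' where "y' = y + z *\<^sub>C x"
      have y': "y' \<in> carr H" using x y by (simp add: y'_def H.carr_add H.carr_scale)
      have limT: "(\<lambda>n. hnorm H (app T (X n) - y')) \<longlonglongrightarrow> 0"
        using H.tendsto_add_hnorm[OF _ y _ H.carr_scale[OF x] lim(2) H.tendsto_scale_hnorm[OF Xc(1) x lim(1), of z]] Xc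
        by (simp add: A_def H.carr_diff H.carr_scale y'_def)
      have xT: "x \<in> Dom T" "app T x = y'"
        using closed_T[unfolded closed_operator_def, rule_format, OF x y'] X' lim(1) limT by blast+
      have "app \<Gamma>0 x = 0"
      proof (rule Gamma0_eq_0I[OF xT(1)])
        fix k assume k: "k \<in> Dom T" "app \<Gamma>0 k = 0"
        have kc: "k \<in> carr H" "app T k \<in> carr H" using k TD by auto
        have eq: "ip H (app T k) (X n) = ip H k (app T (X n))" for n
          using green[OF k(1) X'(1)[of n]]
          by (simp add: k X' G.ip_zero_left G.ip_zero_right Gamma_carr)
        show "ip H (app T k) x = ip H k (app T x)"
        proof (rule LIMSEQ_unique)
          show "(\<lambda>n. ip H (app T k) (X n)) \<longlonglongrightarrow> ip H (app T k) x"
            by (rule H.tendsto_ip_right[OF Xc(1) x kc(2) lim(1)])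
          show "(\<lambda>n. ip H (app T k) (X n)) \<longlonglongrightarrow> ip H k (app T x)"
            unfolding eq xT(2) by (rule H.tendsto_ip_right[OF Xc(2) y' kc(1) limT])
        qed
      qed
      then show "x \<in> Dom A \<and> app A x = y" using xT by (simp add: A_def y'_def)
    qed
  next
    fix h assume h: "h \<in> carr H" and orth: "\<And>x. x \<in> Dom A \<Longrightarrow> ip H (app A x) h = 0"
    have sym: "ip H (app T k) h = ip H k (cnj z *\<^sub>C h)" if "k \<in> Dom T" "app \<Gamma>0 k = 0" for k
      using orth[of k] that h by (simp add: A_def H.ip_diff_left H.ip_scale_left H.ip_scale_right
          H.carr_scale TD)
    have hT: "h \<in> Dom T" "app T h = cnj z *\<^sub>C h"
      using adjoint_app[OF h H.carr_scale[OF h]] sym S_extension by metis+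
    have "app \<Gamma>0 h = 0" using Gamma0_eq_0I[OF hT(1)] sym hT(2) by simp
    then have "\<bar>Im (cnj z)\<bar> * hnorm H h \<le> 0"
      using hnorm_shift_ge[OF hT(1), of "cnj z"] by (simp add: hT(2) H.hnorm_zero)
    then show "h = 0"
      using z h H.hnorm_nonneg[OF h] by (simp add: mult_le_0_iff H.hnorm_eq_0_iff)
  qed
  then have "h \<in> app A ` Dom A" using h by simp
  then show ?thesis using that by (auto simp: A_def)
qed

end

context boundary_triplet
begin

definition gamma :: "complex \<Rightarrow> 'b \<Rightarrow> 'a" where
  "gamma z = app (op_inverse (op_restrict \<Gamma>0 (ker_shift T z)))"

abbreviation weyl :: "complex \<Rightarrow> ('b, 'b) operator" where
  "weyl \<equiv> weyl_function H S \<Gamma>0 \<Gamma>1"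

lemma ker_shift_iff: "f \<in> ker_shift T z \<longleftrightarrow> f \<in> Dom T \<and> app T f = z *\<^sub>C f"
  by (simp add: ker_shift_def)

lemma bij_betw_Gamma0:
  assumes z: "Im z \<noteq> 0"
  shows "bij_betw (app \<Gamma>0) (ker_shift T z) (carr G)"
  unfolding bij_betw_def
proof
  show "inj_on (app \<Gamma>0) (ker_shift T z)"
  proof (rule inj_onI)
    fix f g assume f: "f \<in> ker_shift T z" and g: "g \<in> ker_shift T z" and eq: "app \<Gamma>0 f = app \<Gamma>0 g"
    have fg: "f \<in> Dom T" "g \<in> Dom T" "app T f = z *\<^sub>C f" "app T g = z *\<^sub>C g"
      using f g by (auto simp: ker_shift_iff)
    have "app T (f - g) - z *\<^sub>C (f - g) = 0"
      using T_diff(2)[OF fg(1,2)] fg by (simp add: scaleC_diff_right)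
    moreover have "app \<Gamma>0 (f - g) = 0" using Gamma_linear(5)[OF fg(1,2)] eq by simp
    ultimately have "\<bar>Im z\<bar> * hnorm H (f - g) \<le> 0"
      using hnorm_shift_ge[OF T_diff(1)[OF fg(1,2)], of z] by (simp add: H.hnorm_zero)
    moreover have "f - g \<in> carr H" using T_diff(1)[OF fg(1,2)] TD(4) by blast
    ultimately show "f = g"
      using z H.hnorm_nonneg[of "f - g"] H.hnorm_eq_0_iff[of "f - g"]
      by (simp add: mult_le_0_iff)
  qed
  show "app \<Gamma>0 ` ker_shift T z = carr G"
  proof
    show "app \<Gamma>0 ` ker_shift T z \<subseteq> carr G" using Gamma_carr by (auto simp: ker_shift_iff)
    show "carr G \<subseteq> app \<Gamma>0 ` ker_shift T z"
    proof
      fix g assume "g \<in> carr G"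
      then obtain f where f: "f \<in> Dom T" "app \<Gamma>0 f = g"
        using boundary_valuesE[OF _ G.carr_zero] by metis
      have "app T f - z *\<^sub>C f \<in> carr H" using f TD by (simp add: H.carr_diff H.carr_scale)
      then obtain k where k: "k \<in> Dom T" "app \<Gamma>0 k = 0" "app T k - z *\<^sub>C k = app T f - z *\<^sub>C f"
        using shift_onto[OF z] by metis
      have "app T f = app T k - z *\<^sub>C k + z *\<^sub>C f" using k(3) by simp
      then have "f - k \<in> ker_shift T z"
        using T_diff[OF f(1) k(1)] by (simp add: ker_shift_iff scaleC_diff_right)
      moreover have "app \<Gamma>0 (f - k) = g" using Gamma_linear(5)[OF f(1) k(1)] f k by simp
      ultimately show "g \<in> app \<Gamma>0 ` ker_shift T z" by blast
    qed
  qed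
qed

lemma restrict_Gamma0:
  "Dom (op_restrict \<Gamma>0 (ker_shift T z)) = ker_shift T z" "app (op_restrict \<Gamma>0 V) = app \<Gamma>0"
  by (auto simp: op_restrict_def Dom_\<Gamma>0 ker_shift_def)

lemma
  assumes z: "Im z \<noteq> 0" and g: "g \<in> carr G"
  shows gamma_ker: "gamma z g \<in> ker_shift T z"
    and gamma_Dom: "gamma z g \<in> Dom T"
    and gamma_carr: "gamma z g \<in> carr H"
    and T_gamma: "app T (gamma z g) = z *\<^sub>C gamma z g"
    and Gamma0_gamma: "app \<Gamma>0 (gamma z g) = g"
proof -
  have im: "g \<in> app \<Gamma>0 ` ker_shift T z" using bij_betw_Gamma0[OF z] g by (simp add: bij_betw_def)
  have eq: "gamma z g = inv_into (ker_shift T z) (app \<Gamma>0) g"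
    by (simp add: gamma_def op_inverse_def restrict_Gamma0)
  show ker: "gamma z g \<in> ker_shift T z" unfolding eq by (rule inv_into_into[OF im])
  then show "gamma z g \<in> Dom T" "app T (gamma z g) = z *\<^sub>C gamma z g"
    by (simp_all add: ker_shift_iff)
  then show "gamma z g \<in> carr H" using TD(4) by blast
  show "app \<Gamma>0 (gamma z g) = g" unfolding eq by (rule f_inv_into_f[OF im])
qed

lemma gamma_eqI:
  assumes z: "Im z \<noteq> 0" and f: "f \<in> Dom T" "app T f = z *\<^sub>C f"
  shows "gamma z (app \<Gamma>0 f) = f"
proof -
  have "inj_on (app \<Gamma>0) (ker_shift T z)" using bij_betw_Gamma0[OF z] by (simp add: bij_betw_def)
  then show ?thesis
    using f by (simp add: gamma_def op_inverse_def restrict_Gamma0 ker_shift_iff inv_into_f_f)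
qed

lemma gamma_add:
  assumes z: "Im z \<noteq> 0" and "g \<in> carr G" "h \<in> carr G"
  shows "gamma z (g + h) = gamma z g + gamma z h"
proof -
  let ?f = "gamma z g + gamma z h"
  have "gamma z (app \<Gamma>0 ?f) = ?f"
    by (rule gamma_eqI[OF z]) (use assms in \<open>simp_all add: TD gamma_Dom T_gamma scaleC_add_right\<close>)
  then show ?thesis using assms by (simp add: Gamma_linear gamma_Dom Gamma0_gamma)
qed

lemma gamma_scale:
  assumes z: "Im z \<noteq> 0" and "g \<in> carr G"
  shows "gamma z (c *\<^sub>C g) = c *\<^sub>C gamma z g"
proof -
  let ?f = "c *\<^sub>C gamma z g"
  have "gamma z (app \<Gamma>0 ?f) = ?f"
    by (rule gamma_eqI[OF z])
      (use assms in \<open>simp_all add: TD gamma_Dom T_gamma scaleC_scaleC mult.commute\<close>)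
  then show ?thesis using assms by (simp add: Gamma_linear gamma_Dom Gamma0_gamma)
qed

lemma Dom_weyl: "Im z \<noteq> 0 \<Longrightarrow> Dom (weyl z) = carr G"
proof -
  assume z: "Im z \<noteq> 0"
  have im: "app \<Gamma>0 ` ker_shift T z = carr G" using bij_betw_Gamma0[OF z] by (simp add: bij_betw_def)
  show ?thesis
    using im gamma_Dom[OF z]
    by (auto simp: weyl_function_def op_comp_def op_inverse_def restrict_Gamma0 Dom_\<Gamma>1 gamma_def)
qed

lemma app_weyl: "app (weyl z) g = app \<Gamma>1 (gamma z g)"
  by (simp add: weyl_function_def op_comp_def gamma_def)

lemma weyl_carr: "\<lbrakk>Im z \<noteq> 0; g \<in> carr G\<rbrakk> \<Longrightarrow> app (weyl z) g \<in> carr G"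
  by (simp add: app_weyl Gamma_carr gamma_Dom)

lemma linear_weyl: "Im z \<noteq> 0 \<Longrightarrow> linear_operator G G (weyl z)"
  unfolding linear_operator_def
  by (auto simp: Dom_weyl G.carr_subspace weyl_carr)
    (simp_all add: app_weyl gamma_add gamma_scale Gamma_linear gamma_Dom)

lemma weyl_identity:
  assumes "Im z \<noteq> 0" "Im w \<noteq> 0" "g \<in> carr G" "h \<in> carr G"
  shows "(z - cnj w) * ip H (gamma z g) (gamma w h)
    = ip G (app (weyl z) g) h - ip G g (app (weyl w) h)"
  using green[OF gamma_Dom[OF assms(1,3)] gamma_Dom[OF assms(2,4)]] assms
  by (simp add: T_gamma Gamma0_gamma app_weyl H.ip_scale_left H.ip_scale_right gamma_carr
      left_diff_distrib)

lemma weyl_adjoint: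
  assumes z: "Im z \<noteq> 0"
  shows "Dom (op_adjoint G (weyl z)) = carr G"
    and "g \<in> carr G \<Longrightarrow> app (op_adjoint G (weyl z)) g = app (weyl (cnj z)) g"
proof -
  have z': "Im (cnj z) \<noteq> 0" using z by simp
  have dense: "densely_defined G (weyl z)"
    unfolding densely_defined_def Dom_weyl[OF z] by (metis G.hnorm_zero cancel_comm_monoid_add_class.diff_cancel)
  have eq: "ip G (app (weyl z) f) g = ip G f (app (weyl (cnj z)) g)"
    if "f \<in> carr G" "g \<in> carr G" for f g
    using weyl_identity[OF z z' that] by simp
  have *: "g \<in> Dom (op_adjoint G (weyl z)) \<and> app (op_adjoint G (weyl z)) g = app (weyl (cnj z)) g"
    if "g \<in> carr G" for g
    using G.op_adjoint_app[OF linear_weyl[OF z] dense that weyl_carr[OF z' that]] eq that Dom_weyl[OF z]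
    by blast
  then show "g \<in> carr G \<Longrightarrow> app (op_adjoint G (weyl z)) g = app (weyl (cnj z)) g" by blast
  have "Dom (op_adjoint G (weyl z)) \<subseteq> carr G" by (auto simp: op_adjoint_def)
  then show "Dom (op_adjoint G (weyl z)) = carr G" using * by blast
qed

abbreviation Im_weyl :: "('b, 'b) operator" where
  "Im_weyl \<equiv> op_Im G (weyl \<i>)"

lemma Dom_Im_weyl: "Dom Im_weyl = carr G"
  by (simp add: op_Im_def op_scale_def op_diff_def Dom_weyl weyl_adjoint)

lemma app_Im_weyl:
  "g \<in> carr G \<Longrightarrow> app Im_weyl g = (1 / (2 * \<i>)) *\<^sub>C (app (weyl \<i>) g - app (weyl (- \<i>)) g)"
  by (simp add: op_Im_def op_scale_def op_diff_def weyl_adjoint)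

lemma Im_weyl_carr: "g \<in> carr G \<Longrightarrow> app Im_weyl g \<in> carr G"
  by (simp add: app_Im_weyl G.carr_scale G.carr_diff weyl_carr)

lemma ip_Im_weyl:
  assumes "g \<in> carr G" "h \<in> carr G"
  shows "ip G (app Im_weyl g) h = ip H (gamma \<i> g) (gamma \<i> h)"
proof -
  have "ip G (app (weyl (- \<i>)) g) h = cnj (ip G h (app (weyl (- \<i>)) g))"
    by (rule G.ip_cnj) (simp_all add: assms weyl_carr)
  also have "\<dots> = cnj (ip G (app (weyl \<i>) h) g)"
    using weyl_identity[of \<i> "- \<i>" h g] assms by simp
  also have "\<dots> = ip G g (app (weyl \<i>) h)"
    by (rule G.ip_cnj[symmetric]) (simp_all add: assms weyl_carr)
  finally have "ip G (app Im_weyl g) h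
      = (ip G (app (weyl \<i>) g) h - ip G g (app (weyl \<i>) h)) / (2 * \<i>)"
    using assms by (simp add: app_Im_weyl G.ip_scale_left G.ip_diff_left G.carr_diff weyl_carr)
  also have "\<dots> = 2 * \<i> * ip H (gamma \<i> g) (gamma \<i> h) / (2 * \<i>)"
    using weyl_identity[of \<i> \<i> g h] assms by simp
  finally show ?thesis by simp
qed

lemma linear_Im_weyl: "linear_operator G G Im_weyl"
  unfolding linear_operator_def Dom_Im_weyl
proof (intro conjI ballI allI G.carr_subspace subset_refl)
  show "app Im_weyl ` carr G \<subseteq> carr G" using Im_weyl_carr by blast
  fix x assume x: "x \<in> carr G"
  show "app Im_weyl (c *\<^sub>C x) = c *\<^sub>C app Im_weyl x" for c
    by (rule G.eq_if_ip_eq) (simp_all add: x Im_weyl_carr G.carr_scale ip_Im_weyl gamma_scale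
        H.ip_scale_left G.ip_scale_left gamma_carr)
  fix y assume y: "y \<in> carr G"
  show "app Im_weyl (x + y) = app Im_weyl x + app Im_weyl y"
    by (rule G.eq_if_ip_eq) (simp_all add: x y Im_weyl_carr G.carr_add ip_Im_weyl gamma_add
        H.ip_add_left G.ip_add_left gamma_carr)
qed

lemma hnorm_gamma_power2:
  "g \<in> carr G \<Longrightarrow> (hnorm H (gamma \<i> g))\<^sup>2 \<le> hnorm G (app Im_weyl g) * hnorm G g"
  using ip_Im_weyl[of g g] G.Cauchy_Schwarz[OF Im_weyl_carr, of g g]
    complex_Re_le_cmod[of "ip H (gamma \<i> g) (gamma \<i> g)"]
  by (simp add: H.hnorm_power2 gamma_carr)

lemma hnorm_gamma_power2':
  assumes g: "g \<in> carr G"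
  shows "(hnorm H (gamma \<i> g))\<^sup>2 \<le> hnorm G (app (weyl \<i>) g) * hnorm G g"
proof -
  let ?a = "ip G (app (weyl \<i>) g) g"
  have "2 * \<i> * complex_of_real ((hnorm H (gamma \<i> g))\<^sup>2) = ?a - cnj ?a"
    using weyl_identity[of \<i> \<i> g g] g G.ip_cnj[of "app (weyl \<i>) g" g]
    by (simp add: H.ip_self gamma_carr weyl_carr)
  then have "(hnorm H (gamma \<i> g))\<^sup>2 = Im ?a" by (simp add: complex_eq_iff)
  also have "\<dots> \<le> cmod ?a" using abs_Im_le_cmod[of ?a] by simp
  also have "\<dots> \<le> hnorm G (app (weyl \<i>) g) * hnorm G g"
    by (rule G.Cauchy_Schwarz) (simp_all add: g weyl_carr)
  finally show ?thesis .
qed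

lemma hnorm_gamma_minus:
  assumes g: "g \<in> carr G"
  shows "hnorm H (gamma (- \<i>) g) = hnorm H (gamma \<i> g)"
proof -
  have "ip G (app (weyl \<i>) g) g = ip G g (app (weyl (- \<i>)) g)"
    "ip G (app (weyl (- \<i>)) g) g = ip G g (app (weyl \<i>) g)"
    using weyl_identity[of \<i> "- \<i>" g g] weyl_identity[of "- \<i>" \<i> g g] g by simp_all
  then have "- 2 * \<i> * ip H (gamma (- \<i>) g) (gamma (- \<i>) g)
      = - (2 * \<i> * ip H (gamma \<i> g) (gamma \<i> g))"
    using weyl_identity[of \<i> \<i> g g] weyl_identity[of "- \<i>" "- \<i>" g g] g by simp
  then show ?thesis by (simp add: hnorm_def)
qed

lemma Im_weyl_inj: "inj_on (app Im_weyl) (Dom Im_weyl)"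
proof (rule inj_onI)
  fix g h assume "g \<in> Dom Im_weyl" "h \<in> Dom Im_weyl" and eq: "app Im_weyl g = app Im_weyl h"
  then have gh: "g \<in> carr G" "h \<in> carr G" "g - h \<in> carr G" by (simp_all add: Dom_Im_weyl G.carr_diff)
  have "app Im_weyl (g - h) = 0"
    using G.linear_operator_diff(2)[OF linear_Im_weyl, of g h] gh eq by (simp add: Dom_Im_weyl)
  then have "(hnorm H (gamma \<i> (g - h)))\<^sup>2 \<le> 0"
    using hnorm_gamma_power2[OF gh(3)] by (simp add: G.hnorm_zero)
  then have "gamma \<i> (g - h) = 0" using H.hnorm_eq_0_iff gamma_carr gh(3) by simp
  then have "g - h = 0"
    using Gamma0_gamma[of \<i>, OF _ gh(3)] linear_operator_zero[OF linear_\<Gamma>0] by simp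
  then show "g = h" by simp
qed

abbreviation graph_norm :: "'a \<Rightarrow> real" where
  "graph_norm f \<equiv> sqrt ((hnorm H f)\<^sup>2 + (hnorm H (app T f))\<^sup>2)"

lemma weyl_bounds_if_graph_bounds:
  assumes b0: "\<And>f. f \<in> Dom T \<Longrightarrow> hnorm G (app \<Gamma>0 f) \<le> C * graph_norm f"
    and b1: "\<And>f. f \<in> Dom T \<Longrightarrow> hnorm G (app \<Gamma>1 f) \<le> C * graph_norm f"
    and g: "g \<in> carr G"
  shows "hnorm G (app (weyl \<i>) g) \<le> 2 * C\<^sup>2 * hnorm G g"
    and "hnorm G g \<le> 2 * C\<^sup>2 * hnorm G (app Im_weyl g)"
proof -
  let ?f = "gamma \<i> g"
  have nonneg: "0 \<le> hnorm G g" "0 \<le> hnorm G (app (weyl \<i>) g)" "0 \<le> hnorm G (app Im_weyl g)"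
    using g by (simp_all add: G.hnorm_nonneg weyl_carr Im_weyl_carr)
  have f: "?f \<in> Dom T" "app \<Gamma>0 ?f = g" "app \<Gamma>1 ?f = app (weyl \<i>) g" 
    using g by (simp_all add: gamma_Dom Gamma0_gamma app_weyl)
  have "(C * graph_norm ?f)\<^sup>2 = 2 * C\<^sup>2 * (hnorm H ?f)\<^sup>2"
    using g by (simp add: T_gamma H.hnorm_scale gamma_carr power_mult_distrib)
  then have *: "(hnorm G g)\<^sup>2 \<le> 2 * C\<^sup>2 * (hnorm H ?f)\<^sup>2"
    "(hnorm G (app (weyl \<i>) g))\<^sup>2 \<le> 2 * C\<^sup>2 * (hnorm H ?f)\<^sup>2"
    using power_mono[OF b0[OF f(1)], of 2] power_mono[OF b1[OF f(1)], of 2] f nonneg by simp_all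
  have "(hnorm G g)\<^sup>2 \<le> (2 * C\<^sup>2 * hnorm G (app Im_weyl g)) * hnorm G g"
    using *(1) mult_left_mono[OF hnorm_gamma_power2[OF g], of "2 * C\<^sup>2"] by (simp add: mult.assoc)
  then show "hnorm G g \<le> 2 * C\<^sup>2 * hnorm G (app Im_weyl g)"
    by (rule le_if_power2_le_mult) (use nonneg in simp_all)
  have "(hnorm G (app (weyl \<i>) g))\<^sup>2 \<le> (2 * C\<^sup>2 * hnorm G g) * hnorm G (app (weyl \<i>) g)"
    using *(2) mult_left_mono[OF hnorm_gamma_power2'[OF g], of "2 * C\<^sup>2"] by (simp add: mult_ac)
  then show "hnorm G (app (weyl \<i>) g) \<le> 2 * C\<^sup>2 * hnorm G g"
    by (rule le_if_power2_le_mult) (use nonneg in simp_all)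
qed

text \<open>Cauchy--Schwarz for the nonnegative form of \<open>Im M(\<i>)\<close> gives
  \<open>\<parallel>Im M(\<i>) g\<parallel>\<^sup>2 \<le> \<parallel>M(\<i>)\<parallel> (Im M(\<i>) g, g)\<close>, which replaces the square root of \<open>Im M(\<i>)\<close>.\<close>

lemma gamma_bounds_if_weyl_bounds:
  assumes C: "C \<ge> 1"
    and W: "\<And>g. g \<in> carr G \<Longrightarrow> hnorm G (app (weyl \<i>) g) \<le> C * hnorm G g"
    and B: "\<And>g. g \<in> carr G \<Longrightarrow> hnorm G g \<le> C * hnorm G (app Im_weyl g)"
    and g: "g \<in> carr G"
  shows "hnorm H (gamma \<i> g) \<le> C * hnorm G g" "hnorm G g \<le> C\<^sup>2 * hnorm H (gamma \<i> g)"
proof -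
  have upper: "hnorm H (gamma \<i> h) \<le> C * hnorm G h" if h: "h \<in> carr G" for h
  proof -
    have "(hnorm H (gamma \<i> h))\<^sup>2 \<le> hnorm G (app (weyl \<i>) h) * hnorm G h"
      by (rule hnorm_gamma_power2'[OF h])
    also have "\<dots> \<le> (C * hnorm G h) * hnorm G h"
      by (rule mult_right_mono[OF W[OF h] G.hnorm_nonneg[OF h]])
    also have "\<dots> \<le> (C * C) * (hnorm G h * hnorm G h)"
      using mult_right_mono[of C "C * C" "hnorm G h * hnorm G h"] C by (simp add: mult.assoc)
    also have "\<dots> = (C * hnorm G h)\<^sup>2" by (simp add: power2_eq_square)
    finally show ?thesis
      by (rule power2_le_imp_le) (use C G.hnorm_nonneg[OF h] in simp)
  qed
  then show "hnorm H (gamma \<i> g) \<le> C * hnorm G g" using g by blast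
  let ?b = "app Im_weyl g"
  have b: "?b \<in> carr G" by (rule Im_weyl_carr[OF g])
  have "(hnorm G ?b)\<^sup>2 = Re (ip H (gamma \<i> g) (gamma \<i> ?b))"
    using ip_Im_weyl[OF g b] by (simp add: G.hnorm_power2 b)
  also have "\<dots> \<le> hnorm H (gamma \<i> g) * hnorm H (gamma \<i> ?b)"
    by (rule order_trans[OF complex_Re_le_cmod H.Cauchy_Schwarz]) (simp_all add: gamma_carr b g)
  also have "\<dots> \<le> hnorm H (gamma \<i> g) * (C * hnorm G ?b)"
    by (rule mult_left_mono[OF upper[OF b]]) (simp add: H.hnorm_nonneg gamma_carr g)
  finally have "(hnorm G ?b)\<^sup>2 \<le> (C * hnorm H (gamma \<i> g)) * hnorm G ?b" by (simp add: mult_ac)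
  then have "hnorm G ?b \<le> C * hnorm H (gamma \<i> g)"
    by (rule le_if_power2_le_mult) (use C b g in \<open>simp_all add: G.hnorm_nonneg H.hnorm_nonneg gamma_carr\<close>)
  then have "C * hnorm G ?b \<le> C * (C * hnorm H (gamma \<i> g))" using C by simp
  then show "hnorm G g \<le> C\<^sup>2 * hnorm H (gamma \<i> g)"
    using B[OF g] by (simp add: power2_eq_square mult.assoc)
qed

lemma graph_bounds_if_weyl_bounds:
  assumes C: "C \<ge> 1"
    and W: "\<And>g. g \<in> carr G \<Longrightarrow> hnorm G (app (weyl \<i>) g) \<le> C * hnorm G g"
    and B: "\<And>g. g \<in> carr G \<Longrightarrow> hnorm G g \<le> C * hnorm G (app Im_weyl g)"
    and f: "f \<in> Dom T"
  shows "hnorm G (app \<Gamma>0 f) \<le> 5 * C ^ 3 * graph_norm f"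
    and "hnorm G (app \<Gamma>1 f) \<le> 5 * C ^ 3 * graph_norm f"
proof -
  have gb: "hnorm H (gamma \<i> x) \<le> C * hnorm G x" "hnorm G x \<le> C\<^sup>2 * hnorm H (gamma \<i> x)"
    if "x \<in> carr G" for x
    using gamma_bounds_if_weyl_bounds[OF C _ _ that] W B by blast+
  let ?N = "graph_norm f"
  define g where "g = app \<Gamma>0 f"
  define k where "k = f - gamma \<i> g"
  have g: "g \<in> carr G" using f by (simp add: g_def Gamma_carr)
  note gam = gamma_Dom[OF _ g, of \<i>] gamma_carr[OF _ g, of \<i>]
  have fc: "f \<in> carr H" "app T f \<in> carr H" using f TD by auto
  have k: "k \<in> Dom T" "app \<Gamma>0 k = 0" "app \<Gamma>1 k = app \<Gamma>1 f - app (weyl \<i>) g"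
    "app T k - \<i> *\<^sub>C k = app T f - \<i> *\<^sub>C f"
    using f g gam T_diff[OF f, of "gamma \<i> g"]
    by (simp_all add: k_def Gamma_linear Gamma0_gamma g_def[symmetric] app_weyl T_gamma
        scaleC_diff_right)
  have N: "hnorm H f \<le> ?N" "hnorm H (app T f) \<le> ?N" by (simp_all add: real_le_rsqrt)
  then have N0: "0 \<le> ?N" by simp
  have "hnorm H (app T f - \<i> *\<^sub>C f) \<le> hnorm H (app T f) + hnorm H (\<i> *\<^sub>C f)"
    by (rule H.hnorm_triangle_diff) (simp_all add: fc H.carr_scale)
  then have Tk: "hnorm H (app T k - \<i> *\<^sub>C k) \<le> 2 * ?N"
    unfolding k(4) H.hnorm_scale[OF fc(1)] norm_ii using N by linarith
  then have kN: "hnorm H k \<le> 2 * ?N" using hnorm_shift_ge[OF k(1,2), of \<i>] by simp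
  have kc: "k \<in> carr H" "app T k - \<i> *\<^sub>C k \<in> carr H"
    using k(1) TD by (simp_all add: H.carr_diff H.carr_scale)
  have gamma_eq: "gamma \<i> g = f - k" by (simp add: k_def)
  have gN: "hnorm H (gamma \<i> g) \<le> 3 * ?N"
    unfolding gamma_eq using H.hnorm_triangle_diff[OF fc(1) kc(1)] kN N(1) by linarith
  have C2: "0 \<le> C\<^sup>2" "C\<^sup>2 \<le> C ^ 3" "C \<le> C ^ 3"
    using C power_increasing[of 2 3 C] power_increasing[of 1 3 C] by simp_all
  have "hnorm G g \<le> C\<^sup>2 * (3 * ?N)"
    using gb(2)[OF g] mult_left_mono[OF gN C2(1)] by linarith
  then have g3: "hnorm G g \<le> 3 * (C\<^sup>2 * ?N)" by simp
  moreover have "C\<^sup>2 * ?N \<le> C ^ 3 * ?N" "C * ?N \<le> C ^ 3 * ?N" "0 \<le> C ^ 3 * ?N"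
    using C C2 N0 by (simp_all add: mult_right_mono del: real_sqrt_ge_0_iff)
  ultimately show "hnorm G (app \<Gamma>0 f) \<le> 5 * C ^ 3 * ?N" by (simp add: g_def)
  define u where "u = app \<Gamma>1 k"
  have u: "u \<in> carr G" unfolding u_def by (rule Gamma_carr(2)[OF k(1)])
  have gu: "gamma (- \<i>) u \<in> Dom T" "gamma (- \<i>) u \<in> carr H"
    using u by (simp_all add: gamma_Dom gamma_carr)
  have "ip H (app T k - \<i> *\<^sub>C k) (gamma (- \<i>) u) = ip G u u"
    using green[OF k(1) gu(1)] u gu TD(4,5)[OF k(1)]
    by (simp add: T_gamma Gamma0_gamma k(2) G.ip_zero_left Gamma_carr H.ip_diff_left H.ip_scale_left
        H.ip_scale_right H.carr_scale flip: u_def)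
  then have "(hnorm G u)\<^sup>2 = Re (ip H (app T k - \<i> *\<^sub>C k) (gamma (- \<i>) u))"
    by (simp add: G.hnorm_power2 u)
  also have "\<dots> \<le> hnorm H (app T k - \<i> *\<^sub>C k) * hnorm H (gamma (- \<i>) u)"
    using H.Cauchy_Schwarz[OF kc(2) gu(2)] complex_Re_le_cmod order_trans by blast
  also have "\<dots> \<le> (2 * ?N) * (C * hnorm G u)"
    using Tk gb(1)[OF u] hnorm_gamma_minus[OF u] N0 gu u
    by (intro mult_mono) (simp_all add: H.hnorm_nonneg gamma_carr)
  finally have "(hnorm G u)\<^sup>2 \<le> (2 * (C * ?N)) * hnorm G u" by (simp add: mult_ac)
  then have uN: "hnorm G u \<le> 2 * (C * ?N)"
    by (rule le_if_power2_le_mult) (use C N0 u in \<open>simp_all add: G.hnorm_nonneg\<close>)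
  have "app \<Gamma>1 f = u + app (weyl \<i>) g" by (simp add: u_def k)
  then have "hnorm G (app \<Gamma>1 f) \<le> hnorm G u + hnorm G (app (weyl \<i>) g)"
    using G.hnorm_triangle[OF u weyl_carr[OF _ g, of \<i>]] by simp
  also have "\<dots> \<le> 2 * (C * ?N) + C * (3 * (C\<^sup>2 * ?N))"
    using uN W[OF g] mult_left_mono[OF g3, of C] C by linarith
  also have "\<dots> = 2 * (C * ?N) + 3 * (C ^ 3 * ?N)" by (simp add: power2_eq_square power3_eq_cube)
  also have "\<dots> \<le> 5 * C ^ 3 * ?N"
    using \<open>C * ?N \<le> C ^ 3 * ?N\<close> by linarith
  finally show "hnorm G (app \<Gamma>1 f) \<le> 5 * C ^ 3 * ?N" .
qed

lemma Im_weyl_onto: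
  assumes C: "C \<ge> 1" and B: "\<And>g. g \<in> carr G \<Longrightarrow> hnorm G g \<le> C * hnorm G (app Im_weyl g)"
  shows "app Im_weyl ` carr G = carr G"
  unfolding Dom_Im_weyl[symmetric]
proof (subst (2) Dom_Im_weyl, rule G.closed_bounded_below_range[OF linear_Im_weyl])
  have sym: "ip G (app Im_weyl x) y = ip G x (app Im_weyl y)" if "x \<in> carr G" "y \<in> carr G" for x y
    using ip_Im_weyl[OF that] ip_Im_weyl[OF that(2,1)] G.ip_cnj[OF Im_weyl_carr[OF that(2)] that(1)]
      H.ip_cnj[OF gamma_carr[OF _ that(2)] gamma_carr[OF _ that(1)], of \<i> \<i>] by simp
  show "closed_operator G Im_weyl"
    unfolding closed_operator_def Dom_Im_weyl
  proof (intro allI ballI impI, elim conjE)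
    fix X x y
    assume x: "x \<in> carr G" and y: "y \<in> carr G" and X: "\<forall>n::nat. X n \<in> carr G"
      and lim: "(\<lambda>n. hnorm G (X n - x)) \<longlonglongrightarrow> 0" "(\<lambda>n. hnorm G (app Im_weyl (X n) - y)) \<longlonglongrightarrow> 0"
    have Xc: "X n \<in> carr G" "app Im_weyl (X n) \<in> carr G" for n using X Im_weyl_carr by auto
    have "app Im_weyl x = y"
    proof (rule G.eq_if_ip_eq[OF Im_weyl_carr[OF x] y])
      fix z assume z: "z \<in> carr G"
      show "ip G (app Im_weyl x) z = ip G y z"
      proof (rule LIMSEQ_unique)
        show "(\<lambda>n. ip G (app Im_weyl (X n)) z) \<longlonglongrightarrow> ip G (app Im_weyl x) z"
          unfolding sym[OF Xc(1) z] sym[OF x z]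
          by (rule G.tendsto_ip_left[OF Xc(1) x Im_weyl_carr[OF z] lim(1)])
        show "(\<lambda>n. ip G (app Im_weyl (X n)) z) \<longlonglongrightarrow> ip G y z"
          by (rule G.tendsto_ip_left[OF Xc(2) y z lim(2)])
      qed
    qed
    then show "x \<in> carr G \<and> app Im_weyl x = y" using x by simp
  qed
  show "0 < 1 / C" using C by simp
  show "1 / C * hnorm G x \<le> hnorm G (app Im_weyl x)" if "x \<in> Dom Im_weyl" for x
    using B[of x] that C by (simp add: Dom_Im_weyl field_simps)
  fix y assume y: "y \<in> carr G" and orth: "\<And>x. x \<in> Dom Im_weyl \<Longrightarrow> ip G (app Im_weyl x) y = 0"
  have "ip G x (app Im_weyl y) = 0" if "x \<in> carr G" for x
    using orth[of x] that sym[OF that y] by (simp add: Dom_Im_weyl)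
  then have "hnorm G (app Im_weyl y) = 0" using Im_weyl_carr[OF y] by (simp add: hnorm_def)
  then show "y = 0"
    using B[OF y] G.hnorm_nonneg[OF y] G.hnorm_eq_0_iff[OF y] by simp
qed

text \<open>The lift is sought in the span of the two deficiency spaces: \<open>\<gamma>(\<i>) u - \<gamma>(-\<i>) u\<close> lies in the kernel
  of \<open>\<Gamma>0\<close> and \<open>\<Gamma>1\<close> maps it to \<open>2 \<i> Im M(\<i>) u\<close>.\<close>

lemma boundary_values_lift:
  assumes C: "C \<ge> 1"
    and W: "\<And>g. g \<in> carr G \<Longrightarrow> hnorm G (app (weyl \<i>) g) \<le> C * hnorm G g"
    and B: "\<And>g. g \<in> carr G \<Longrightarrow> hnorm G g \<le> C * hnorm G (app Im_weyl g)"
    and g: "g \<in> carr G" and h: "h \<in> carr G"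
  obtains f where "f \<in> Dom T" "app \<Gamma>0 f = g" "app \<Gamma>1 f = h"
    "hnorm H f \<le> 3 * C ^ 3 * (hnorm G g + hnorm G h)"
    "hnorm H (app T f) \<le> 3 * C ^ 3 * (hnorm G g + hnorm G h)"
proof -
  have gb: "hnorm H (gamma \<i> x) \<le> C * hnorm G x" "hnorm G x \<le> C\<^sup>2 * hnorm H (gamma \<i> x)"
    if "x \<in> carr G" for x
    using gamma_bounds_if_weyl_bounds[OF C _ _ that] W B by blast+
  let ?k = "h - app (weyl \<i>) g" and ?c = "1 / (2 * \<i>)"
  have Wg: "app (weyl \<i>) g \<in> carr G" using g by (simp add: weyl_carr)
  then have k: "?k \<in> carr G" using h by (simp add: G.carr_diff)
  then have "?c *\<^sub>C ?k \<in> app Im_weyl ` carr G" using Im_weyl_onto[OF C B] G.carr_scale by simp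
  then obtain u where u: "u \<in> carr G" "app Im_weyl u = ?c *\<^sub>C ?k" by auto
  have "(2 * \<i>) *\<^sub>C (?c *\<^sub>C (app (weyl \<i>) u - app (weyl (- \<i>)) u)) = (2 * \<i>) *\<^sub>C (?c *\<^sub>C ?k)"
    using u by (simp add: app_Im_weyl)
  then have uk: "app (weyl \<i>) u - app (weyl (- \<i>)) u = ?k" by (simp add: scaleC_scaleC scaleC_one)
  define p where "p = gamma \<i> (g + u)"
  define q where "q = gamma (- \<i>) u"
  have gu: "g + u \<in> carr G" using g u by (simp add: G.carr_add)
  have p: "p \<in> Dom T" "p \<in> carr H" "app T p = \<i> *\<^sub>C p" "app \<Gamma>0 p = g + u"
    "app \<Gamma>1 p = app (weyl \<i>) g + app (weyl \<i>) u"
    using gu linear_operatorD(6)[OF linear_weyl[of \<i>], of g u] g u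
    by (simp_all add: p_def gamma_Dom gamma_carr T_gamma Gamma0_gamma Dom_weyl app_weyl)
  have q: "q \<in> Dom T" "q \<in> carr H" "app T q = (- \<i>) *\<^sub>C q" "app \<Gamma>0 q = u"
    "app \<Gamma>1 q = app (weyl (- \<i>)) u"
    using u by (simp_all add: q_def gamma_Dom gamma_carr T_gamma Gamma0_gamma app_weyl)
  have "hnorm G ?k \<le> hnorm G h + C * hnorm G g"
    using G.hnorm_triangle_diff[OF h Wg] W[OF g] by linarith
  moreover have "hnorm G u \<le> C * (hnorm G ?k / 2)"
    using B[OF u(1)] k by (simp add: u(2) G.hnorm_scale norm_divide norm_mult)
  ultimately have "2 * hnorm G u \<le> C * (hnorm G h + C * hnorm G g)"
    using mult_left_mono[of "hnorm G ?k" "hnorm G h + C * hnorm G g" C] C by linarith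
  then have "hnorm G g + 2 * hnorm G u \<le> hnorm G g + C * (hnorm G h + C * hnorm G g)" by simp
  then have "C * (hnorm G g + 2 * hnorm G u) \<le> C * (hnorm G g + C * (hnorm G h + C * hnorm G g))"
    using C by simp
  also have "\<dots> = (C + C ^ 3) * hnorm G g + C\<^sup>2 * hnorm G h"
    by (simp add: algebra_simps power2_eq_square power3_eq_cube)
  also have "\<dots> \<le> 3 * C ^ 3 * hnorm G g + 3 * C ^ 3 * hnorm G h"
    using C power_increasing[of 2 3 C] power_increasing[of 1 3 C] g h
    by (intro add_mono mult_right_mono) (simp_all add: G.hnorm_nonneg)
  finally have bound: "C * (hnorm G g + 2 * hnorm G u) \<le> 3 * C ^ 3 * (hnorm G g + hnorm G h)"
    by (simp add: algebra_simps)
  have "hnorm H p \<le> C * (hnorm G g + hnorm G u)"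
    using gb(1)[OF gu] mult_left_mono[OF G.hnorm_triangle[OF g u(1)], of C] C
    unfolding p_def by linarith
  moreover have "hnorm H q \<le> C * hnorm G u"
    using gb(1)[OF u(1)] hnorm_gamma_minus[OF u(1)] by (simp add: q_def)
  ultimately have pq: "hnorm H p + hnorm H q \<le> 3 * C ^ 3 * (hnorm G g + hnorm G h)"
    using bound by (simp add: algebra_simps)
  have "app T (p - q) = \<i> *\<^sub>C p - (- \<i>) *\<^sub>C q" using T_diff(2)[OF p(1) q(1)] p q by simp
  then have "hnorm H (app T (p - q)) \<le> hnorm H (\<i> *\<^sub>C p) + hnorm H ((- \<i>) *\<^sub>C q)"
    using H.hnorm_triangle_diff[of "\<i> *\<^sub>C p" "(- \<i>) *\<^sub>C q"] p q H.carr_scale by simp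
  then have T_bound: "hnorm H (app T (p - q)) \<le> 3 * C ^ 3 * (hnorm G g + hnorm G h)"
    using pq p q by (simp add: H.hnorm_scale)
  have "app \<Gamma>1 (p - q) = h"
    using Gamma_linear(6)[OF p(1) q(1)] p q uk by (simp add: algebra_simps)
  moreover have "app \<Gamma>0 (p - q) = g" using Gamma_linear(5)[OF p(1) q(1)] p q by simp
  moreover have "p - q \<in> Dom T" using T_diff(1)[OF p(1) q(1)] .
  moreover have "hnorm H (p - q) \<le> 3 * C ^ 3 * (hnorm G g + hnorm G h)"
    using H.hnorm_triangle_diff[OF p(2) q(2)] pq by linarith
  ultimately show ?thesis using that T_bound by blast
qed

end

section \<open>Direct sums of Hilbert spaces\<close>

definition at_index :: "nat \<Rightarrow> 'a::zero \<Rightarrow> nat \<Rightarrow> 'a" where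
  "at_index n x = (\<lambda>m. if m = n then x else 0)"

lemma at_index_apply: "at_index n x m = (if m = n then x else 0)"
  by (simp add: at_index_def)

lemma at_index_inject: "x \<noteq> 0 \<Longrightarrow> at_index n x = at_index m y \<longleftrightarrow> n = m \<and> x = y"
  by (auto simp: at_index_def fun_eq_iff)

locale hilbert_family =
  fixes H :: "nat \<Rightarrow> 'a::complex_vector inner_space"
  assumes hilbert: "complex_hilbert_space (H n)"
begin

sublocale comp: complex_hilbert_space "H n" for n
  by (rule hilbert)

lemma mem_sum_iff:
  "f \<in> carr (hilbert_sum H) \<longleftrightarrow> (\<forall>n. f n \<in> carr (H n)) \<and> summable (\<lambda>n. (hnorm (H n) (f n))\<^sup>2)"
  by (simp add: hilbert_sum_def)

lemma ip_sum: "ip (hilbert_sum H) f g = (\<Sum>n. ip (H n) (f n) (g n))"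
  by (simp add: hilbert_sum_def)

lemma sum_comp_carr: "f \<in> carr (hilbert_sum H) \<Longrightarrow> f n \<in> carr (H n)"
  by (simp add: mem_sum_iff)

lemma summable_ip:
  assumes f: "f \<in> carr (hilbert_sum H)" and g: "g \<in> carr (hilbert_sum H)"
  shows "summable (\<lambda>n. ip (H n) (f n) (g n))"
proof (rule summable_comparison_test')
  show "summable (\<lambda>n. (hnorm (H n) (f n))\<^sup>2 + (hnorm (H n) (g n))\<^sup>2)"
    using f g by (intro summable_add) (simp_all add: mem_sum_iff)
  fix n
  have fg: "f n \<in> carr (H n)" "g n \<in> carr (H n)" using f g by (simp_all add: mem_sum_iff)
  let ?a = "hnorm (H n) (f n)" and ?b = "hnorm (H n) (g n)"
  have "cmod (ip (H n) (f n) (g n)) \<le> ?a * ?b" using comp.Cauchy_Schwarz[OF fg] .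
  also have "\<dots> \<le> ?a\<^sup>2 + ?b\<^sup>2"
    using sum_squares_bound[of ?a ?b]
      mult_nonneg_nonneg[OF comp.hnorm_nonneg[OF fg(1)] comp.hnorm_nonneg[OF fg(2)]] by linarith
  finally show "norm (ip (H n) (f n) (g n)) \<le> ?a\<^sup>2 + ?b\<^sup>2" .
qed

lemma sum_carr_subspace: "csubspace (carr (hilbert_sum H))"
  unfolding csubspace_def
proof (intro conjI ballI allI)
  show "0 \<in> carr (hilbert_sum H)"
    by (simp add: mem_sum_iff zero_fun_def comp.carr_zero comp.hnorm_zero)
  fix f assume f: "f \<in> carr (hilbert_sum H)"
  show "c *\<^sub>C f \<in> carr (hilbert_sum H)" for c
    using f summable_mult[of "\<lambda>n. (hnorm (H n) (f n))\<^sup>2" "(cmod c)\<^sup>2"]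
    by (simp add: mem_sum_iff scaleC_fun_def comp.carr_scale comp.hnorm_scale power_mult_distrib)
  fix g assume g: "g \<in> carr (hilbert_sum H)"
  have fg: "f n \<in> carr (H n)" "g n \<in> carr (H n)" for n using f g by (simp_all add: mem_sum_iff)
  have "summable (\<lambda>n. (hnorm (H n) (f n + g n))\<^sup>2)"
  proof (rule summable_comparison_test')
    show "summable (\<lambda>n. 2 * (hnorm (H n) (f n))\<^sup>2 + 2 * (hnorm (H n) (g n))\<^sup>2)"
      using f g by (intro summable_add summable_mult) (simp_all add: mem_sum_iff)
    show "norm ((hnorm (H n) (f n + g n))\<^sup>2) \<le> 2 * (hnorm (H n) (f n))\<^sup>2 + 2 * (hnorm (H n) (g n))\<^sup>2" for n
      using comp.hnorm_add_power2_le[OF fg] by simp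
  qed
  then show "f + g \<in> carr (hilbert_sum H)"
    using fg by (simp add: mem_sum_iff plus_fun_def comp.carr_add)
qed

lemma sum_carr_diff:
  assumes f: "f \<in> carr (hilbert_sum H)" and g: "g \<in> carr (hilbert_sum H)"
  shows "f - g \<in> carr (hilbert_sum H)"
proof -
  have "(- 1) *\<^sub>C g = - g" by (rule comp.scaleC_minus_one)
  then show ?thesis
    using f g sum_carr_subspace unfolding csubspace_def
    by (metis add_uminus_conv_diff)
qed

lemma ip_sum_self:
  assumes f: "f \<in> carr (hilbert_sum H)"
  shows "ip (hilbert_sum H) f f = complex_of_real (\<Sum>n. (hnorm (H n) (f n))\<^sup>2)"
proof -
  have "(\<lambda>n. complex_of_real ((hnorm (H n) (f n))\<^sup>2)) sums complex_of_real (\<Sum>n. (hnorm (H n) (f n))\<^sup>2)"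
    using f by (intro sums_of_real summable_sums) (simp add: mem_sum_iff)
  moreover have "ip (H n) (f n) (f n) = complex_of_real ((hnorm (H n) (f n))\<^sup>2)" for n
    using comp.ip_self[OF sum_comp_carr[OF f]] .
  ultimately show ?thesis by (simp add: ip_sum sums_unique[symmetric])
qed

lemma
  assumes f: "f \<in> carr (hilbert_sum H)"
  shows hnorm_sum_power2: "(hnorm (hilbert_sum H) f)\<^sup>2 = (\<Sum>n. (hnorm (H n) (f n))\<^sup>2)"
    and hnorm_sum_nonneg: "0 \<le> hnorm (hilbert_sum H) f"
proof -
  have "0 \<le> (\<Sum>n. (hnorm (H n) (f n))\<^sup>2)"
    using f by (intro suminf_nonneg) (simp_all add: mem_sum_iff)
  then show "(hnorm (hilbert_sum H) f)\<^sup>2 = (\<Sum>n. (hnorm (H n) (f n))\<^sup>2)"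
    "0 \<le> hnorm (hilbert_sum H) f"
    using ip_sum_self[OF f] by (simp_all add: hnorm_def)
qed

lemma partial_sum_le_hnorm_sum:
  assumes f: "f \<in> carr (hilbert_sum H)"
  shows "(\<Sum>n<m. (hnorm (H n) (f n))\<^sup>2) \<le> (hnorm (hilbert_sum H) f)\<^sup>2"
  unfolding hnorm_sum_power2[OF f] using f by (intro sum_le_suminf) (simp_all add: mem_sum_iff)

lemma hnorm_comp_le:
  assumes f: "f \<in> carr (hilbert_sum H)"
  shows "hnorm (H n) (f n) \<le> hnorm (hilbert_sum H) f"
proof -
  have "(hnorm (H n) (f n))\<^sup>2 \<le> (\<Sum>n<Suc n. (hnorm (H n) (f n))\<^sup>2)"
    by (simp add: sum_nonneg)
  also have "\<dots> \<le> (hnorm (hilbert_sum H) f)\<^sup>2" by (rule partial_sum_le_hnorm_sum[OF f])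
  finally show ?thesis by (rule power2_le_imp_le) (rule hnorm_sum_nonneg[OF f])
qed

lemma tendsto_comp:
  assumes X: "\<And>k. X k \<in> carr (hilbert_sum H)" and x: "x \<in> carr (hilbert_sum H)"
    and lim: "(\<lambda>k. hnorm (hilbert_sum H) (X k - x)) \<longlonglongrightarrow> 0"
  shows "(\<lambda>k. hnorm (H n) (X k n - x n)) \<longlonglongrightarrow> 0"
proof (rule tendsto_null_dominated[OF _ lim])
  fix k
  have "X k n - x n \<in> carr (H n)" using X x by (simp add: sum_comp_carr comp.carr_diff)
  then show "norm (hnorm (H n) (X k n - x n)) \<le> hnorm (hilbert_sum H) (X k - x)"
    using hnorm_comp_le[OF sum_carr_diff[OF X x], of n] by (simp add: comp.hnorm_nonneg)
qed

lemma sum_complete: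
  assumes X: "\<And>k. X k \<in> carr (hilbert_sum H)"
    and cauchy: "\<forall>e>0. \<exists>N. \<forall>j\<ge>N. \<forall>k\<ge>N. hnorm (hilbert_sum H) (X j - X k) < e"
  shows "\<exists>x\<in>carr (hilbert_sum H). (\<lambda>k::nat. hnorm (hilbert_sum H) (X k - x)) \<longlonglongrightarrow> 0"
proof -
  have Xc: "X k n \<in> carr (H n)" for k n using X by (simp add: sum_comp_carr)
  have "\<exists>x\<in>carr (H n). (\<lambda>k. hnorm (H n) (X k n - x)) \<longlonglongrightarrow> 0" for n
  proof (rule comp.complete[OF Xc], intro allI impI)
    fix e :: real assume "e > 0"
    then obtain N where N: "\<And>j k. \<lbrakk>j \<ge> N; k \<ge> N\<rbrakk> \<Longrightarrow> hnorm (hilbert_sum H) (X j - X k) < e"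
      using cauchy by blast
    have "hnorm (H n) (X j n - X k n) < e" if "j \<ge> N" "k \<ge> N" for j k
      using hnorm_comp_le[OF sum_carr_diff[OF X X], of n j k] N[OF that] by simp
    then show "\<exists>N. \<forall>j\<ge>N. \<forall>k\<ge>N. hnorm (H n) (X j n - X k n) < e" by blast
  qed
  then obtain x where xc: "\<And>n. x n \<in> carr (H n)"
    and lim: "\<And>n. (\<lambda>k. hnorm (H n) (X k n - x n)) \<longlonglongrightarrow> 0" by metis
  have close: "X j - x \<in> carr (hilbert_sum H) \<and> hnorm (hilbert_sum H) (X j - x) \<le> e"
    if e: "e > 0" and N: "\<And>k. k \<ge> N \<Longrightarrow> hnorm (hilbert_sum H) (X j - X k) < e" for e j N
  proof -
    have partial: "(\<Sum>n<m. (hnorm (H n) (X j n - x n))\<^sup>2) \<le> e\<^sup>2" for m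
    proof (rule LIMSEQ_le_const2)
      show "(\<lambda>k. \<Sum>n<m. (hnorm (H n) (X j n - X k n))\<^sup>2) \<longlonglongrightarrow> (\<Sum>n<m. (hnorm (H n) (X j n - x n))\<^sup>2)"
        by (intro tendsto_sum tendsto_power comp.tendsto_hnorm_diff Xc xc lim)
      have "(\<Sum>n<m. (hnorm (H n) (X j n - X k n))\<^sup>2) \<le> e\<^sup>2" if "k \<ge> N" for k
      proof -
        have "(\<Sum>n<m. (hnorm (H n) (X j n - X k n))\<^sup>2) \<le> (hnorm (hilbert_sum H) (X j - X k))\<^sup>2"
          using partial_sum_le_hnorm_sum[OF sum_carr_diff[OF X X], of j k m] by simp
        also have "\<dots> \<le> e\<^sup>2"
          by (rule power_mono) (use N[OF that] hnorm_sum_nonneg[OF sum_carr_diff[OF X X]] in simp_all)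
        finally show ?thesis .
      qed
      then show "\<exists>N. \<forall>k\<ge>N. (\<Sum>n<m. (hnorm (H n) (X j n - X k n))\<^sup>2) \<le> e\<^sup>2" by blast
    qed
    have summable: "summable (\<lambda>n. (hnorm (H n) (X j n - x n))\<^sup>2)"
      by (rule summableI_nonneg_bounded[of _ "e\<^sup>2"]) (use partial in simp_all)
    then have c: "X j - x \<in> carr (hilbert_sum H)" by (simp add: mem_sum_iff comp.carr_diff Xc xc)
    have "(hnorm (hilbert_sum H) (X j - x))\<^sup>2 \<le> e\<^sup>2"
      unfolding hnorm_sum_power2[OF c] using summable partial by (simp add: suminf_le_const)
    then show ?thesis using c e power2_le_imp_le[of _ e] by auto
  qed
  obtain N where "\<And>k. k \<ge> N \<Longrightarrow> hnorm (hilbert_sum H) (X N - X k) < 1"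
    using cauchy zero_less_one by (metis order_refl)
  then have "X N - x \<in> carr (hilbert_sum H)" using close[of 1 N N] by simp
  then have "X N - (X N - x) \<in> carr (hilbert_sum H)" by (rule sum_carr_diff[OF X])
  then have x: "x \<in> carr (hilbert_sum H)" by simp
  moreover have "(\<lambda>k. hnorm (hilbert_sum H) (X k - x)) \<longlonglongrightarrow> 0"
  proof (rule LIMSEQ_I)
    fix e :: real assume e: "0 < e"
    then obtain N where N: "\<And>j k. \<lbrakk>j \<ge> N; k \<ge> N\<rbrakk> \<Longrightarrow> hnorm (hilbert_sum H) (X j - X k) < e / 2"
      using cauchy by (metis half_gt_zero)
    have "norm (hnorm (hilbert_sum H) (X j - x) - 0) < e" if j: "j \<ge> N" for j
      using close[of "e / 2" N j] N[OF j] e hnorm_sum_nonneg[OF sum_carr_diff[OF X x], of j] by simp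
    then show "\<exists>N. \<forall>j\<ge>N. norm (hnorm (hilbert_sum H) (X j - x) - 0) < e" by blast
  qed
  ultimately show ?thesis by blast
qed

sublocale sum: complex_hilbert_space "hilbert_sum H"
proof
  show "csubspace (carr (hilbert_sum H))" by (rule sum_carr_subspace)
  show "ip (hilbert_sum H) (x + y) z = ip (hilbert_sum H) x z + ip (hilbert_sum H) y z"
    if "x \<in> carr (hilbert_sum H)" "y \<in> carr (hilbert_sum H)" "z \<in> carr (hilbert_sum H)" for x y z
    using that
    by (simp add: ip_sum suminf_add summable_ip plus_fun_def comp.ip_add_left sum_comp_carr)
  show "ip (hilbert_sum H) (c *\<^sub>C x) y = c * ip (hilbert_sum H) x y"
    if "x \<in> carr (hilbert_sum H)" "y \<in> carr (hilbert_sum H)" for x y c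
    using that
    by (simp add: ip_sum suminf_mult summable_ip scaleC_fun_def comp.ip_scale_left sum_comp_carr)
  show "ip (hilbert_sum H) y x = cnj (ip (hilbert_sum H) x y)"
    if x: "x \<in> carr (hilbert_sum H)" and y: "y \<in> carr (hilbert_sum H)" for x y
  proof -
    have "(\<lambda>n. ip (H n) (y n) (x n)) = (\<lambda>n. cnj (ip (H n) (x n) (y n)))"
      using comp.ip_cnj[OF sum_comp_carr[OF x] sum_comp_carr[OF y]] by blast
    moreover have "(\<lambda>n. cnj (ip (H n) (x n) (y n))) sums cnj (ip (hilbert_sum H) x y)"
      unfolding sums_cnj ip_sum using summable_ip[OF x y] by (rule summable_sums)
    ultimately show ?thesis by (simp add: ip_sum sums_unique[symmetric])
  qed
  show "0 < Re (ip (hilbert_sum H) x x)"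
    if x: "x \<in> carr (hilbert_sum H)" and "x \<noteq> 0" for x
  proof -
    obtain n where "x n \<noteq> 0" using \<open>x \<noteq> 0\<close> by (auto simp: zero_fun_def)
    then have "0 < (hnorm (H n) (x n))\<^sup>2"
      using comp.hnorm_eq_0_iff[OF sum_comp_carr[OF x]] by simp
    also have "\<dots> \<le> (hnorm (hilbert_sum H) x)\<^sup>2"
      using hnorm_comp_le[OF x] comp.hnorm_nonneg[OF sum_comp_carr[OF x]] by (rule power_mono)
    finally show ?thesis using ip_sum_self[OF x] hnorm_sum_power2[OF x] by simp
  qed
  show "\<exists>x\<in>carr (hilbert_sum H). (\<lambda>n. hnorm (hilbert_sum H) (X n - x)) \<longlonglongrightarrow> 0"
    if "\<And>n. X n \<in> carr (hilbert_sum H)"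
      "\<forall>e>0. \<exists>N. \<forall>m\<ge>N. \<forall>n\<ge>N. hnorm (hilbert_sum H) (X m - X n) < e" for X :: "nat \<Rightarrow> nat \<Rightarrow> 'a"
    using sum_complete that by blast
qed

lemma at_index_carr: "x \<in> carr (H n) \<Longrightarrow> at_index n x \<in> carr (hilbert_sum H)"
proof -
  assume x: "x \<in> carr (H n)"
  have "summable (\<lambda>m. (hnorm (H m) (at_index n x m))\<^sup>2)"
    by (rule summable_finite[of "{n}"]) (simp_all add: at_index_apply comp.hnorm_zero)
  then show ?thesis using x by (simp add: mem_sum_iff at_index_apply comp.carr_zero)
qed

lemma ip_at_index:
  assumes f: "f \<in> carr (hilbert_sum H)"
  shows "ip (hilbert_sum H) f (at_index n x) = ip (H n) (f n) x"
proof -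
  have "(\<Sum>m. ip (H m) (f m) (at_index n x m)) = (\<Sum>m\<in>{n}. ip (H m) (f m) (at_index n x m))"
    by (rule suminf_finite) (use f in \<open>auto simp: at_index_apply comp.ip_zero_right sum_comp_carr\<close>)
  then show ?thesis by (simp add: ip_sum at_index_apply)
qed

lemma hnorm_at_index: "x \<in> carr (H n) \<Longrightarrow> hnorm (hilbert_sum H) (at_index n x) = hnorm (H n) x"
  by (simp add: hnorm_def ip_at_index at_index_carr) (simp add: at_index_apply)

lemma densely_defined_operator_sum:
  assumes T: "\<And>n. 0 \<in> Dom (T n)" "\<And>n. app (T n) 0 = 0" "\<And>n. Dom (T n) \<subseteq> carr (H n)"
    and dense: "\<And>n. densely_defined (H n) (T n)" and K: "\<And>n. hnorm (K n) 0 = 0"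
  shows "densely_defined (hilbert_sum H) (operator_sum H K T)"
  unfolding densely_defined_def
proof (intro ballI allI impI)
  fix x and e :: real assume x: "x \<in> carr (hilbert_sum H)" and e: "0 < e"
  let ?s = "\<lambda>n. (hnorm (H n) (x n))\<^sup>2"
  have xs: "summable ?s" using x by (simp add: mem_sum_iff)
  have e2: "0 < e\<^sup>2 / 2" using e by simp
  obtain N where N: "norm (\<Sum>i. ?s (i + N)) < e\<^sup>2 / 2"
    using suminf_exist_split[OF e2 xs] by blast
  define d where "d = sqrt (e\<^sup>2 / (2 * (real N + 1)))"
  have d: "d > 0" using e by (simp add: d_def)
  have "\<forall>n. \<exists>y. y \<in> Dom (T n) \<and> hnorm (H n) (x n - y) < d"
    using dense d sum_comp_carr[OF x] unfolding densely_defined_def by blast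
  then obtain y where y: "\<And>n. y n \<in> Dom (T n)" "\<And>n. hnorm (H n) (x n - y n) < d" by metis
  define z where "z = (\<lambda>n. if n < N then y n else 0)"
  have zD: "z n \<in> Dom (T n)" for n using y(1) T(1) by (simp add: z_def)
  then have zc: "z n \<in> carr (H n)" for n using T(3) by blast
  have "summable (\<lambda>n. (hnorm (H n) (z n))\<^sup>2)"
    "summable (\<lambda>n. (hnorm (K n) (app (T n) (z n)))\<^sup>2)"
    by (rule summable_finite[of "{..<N}"]; simp add: z_def comp.hnorm_zero T(2) K)+
  then have z: "z \<in> Dom (operator_sum H K T)" "z \<in> carr (hilbert_sum H)"
    using zc zD by (simp_all add: operator_sum_def mem_sum_iff)
  have xz: "x - z \<in> carr (hilbert_sum H)" by (rule sum_carr_diff[OF x z(2)])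
  have "(\<Sum>n<N. (hnorm (H n) ((x - z) n))\<^sup>2) \<le> real N * d\<^sup>2"
  proof -
    have "(hnorm (H n) ((x - z) n))\<^sup>2 \<le> d\<^sup>2" if "n < N" for n
      using that y(2)[of n] comp.hnorm_nonneg[OF sum_comp_carr[OF xz], of n]
      by (intro power_mono) (simp_all add: z_def)
    then show ?thesis
      using sum_bounded_above[of "{..<N}" "\<lambda>n. (hnorm (H n) ((x - z) n))\<^sup>2" "d\<^sup>2"] by simp
  qed
  also have "\<dots> \<le> e\<^sup>2 / 2" by (simp add: d_def field_simps)
  finally have "(\<Sum>n<N. (hnorm (H n) ((x - z) n))\<^sup>2) \<le> e\<^sup>2 / 2" .
  moreover have "(\<Sum>n. (hnorm (H (n + N)) ((x - z) (n + N)))\<^sup>2) < e\<^sup>2 / 2"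
    using N by (simp add: z_def abs_less_iff)
  moreover have "(hnorm (hilbert_sum H) (x - z))\<^sup>2 =
      (\<Sum>n. (hnorm (H (n + N)) ((x - z) (n + N)))\<^sup>2) + (\<Sum>n<N. (hnorm (H n) ((x - z) n))\<^sup>2)"
    unfolding hnorm_sum_power2[OF xz]
    using xz by (intro suminf_split_initial_segment) (simp add: mem_sum_iff)
  ultimately have "(hnorm (hilbert_sum H) (x - z))\<^sup>2 < e\<^sup>2" by simp
  then have "hnorm (hilbert_sum H) (x - z) < e" using e by (simp add: power2_less_imp_less)
  then show "\<exists>y\<in>Dom (operator_sum H K T). hnorm (hilbert_sum H) (x - y) < e" using z by blast
qed

lemma closed_operator_sum:
  assumes T: "\<And>n. closed_operator (H n) (T n)"
    and range: "\<And>n. app (T n) ` Dom (T n) \<subseteq> carr (H n)"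
  shows "closed_operator (hilbert_sum H) (operator_sum H H T)"
  unfolding closed_operator_def
proof (intro allI ballI impI, elim conjE)
  fix X x y
  assume x: "x \<in> carr (hilbert_sum H)" and y: "y \<in> carr (hilbert_sum H)"
    and XD: "\<forall>k::nat. X k \<in> Dom (operator_sum H H T)"
    and lim: "(\<lambda>k. hnorm (hilbert_sum H) (X k - x)) \<longlonglongrightarrow> 0"
      "(\<lambda>k. hnorm (hilbert_sum H) (app (operator_sum H H T) (X k) - y)) \<longlonglongrightarrow> 0"
  have X: "X k \<in> carr (hilbert_sum H)" "X k n \<in> Dom (T n)"
    "(\<lambda>n. app (T n) (X k n)) \<in> carr (hilbert_sum H)" for k n
    using XD range by (auto simp: operator_sum_def mem_sum_iff image_subset_iff)
  have lim2: "(\<lambda>k. hnorm (hilbert_sum H) ((\<lambda>n. app (T n) (X k n)) - y)) \<longlonglongrightarrow> 0"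
    using lim(2) by (simp add: operator_sum_def)
  have "x n \<in> Dom (T n) \<and> app (T n) (x n) = y n" for n
    using T[unfolded closed_operator_def, rule_format, of "x n" n "y n" "\<lambda>k. X k n"]
      tendsto_comp[OF X(1) x lim(1), of n] tendsto_comp[OF X(3) y lim2, of n] X(2)
      sum_comp_carr[OF x] sum_comp_carr[OF y] by blast
  then show "x \<in> Dom (operator_sum H H T) \<and> app (operator_sum H H T) x = y"
    using x y by (simp add: operator_sum_def mem_sum_iff)
qed

lemma symmetric_operator_sum:
  "(\<And>n. symmetric_operator (H n) (T n)) \<Longrightarrow> symmetric_operator (hilbert_sum H) (operator_sum H H T)"
  by (simp add: symmetric_operator_def operator_sum_def ip_sum)

end

lemma linear_operator_sum:
  assumes H: "hilbert_family H" and K: "hilbert_family K"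
    and T: "\<And>n. linear_operator (H n) (K n) (T n)"
  shows "linear_operator (hilbert_sum H) (hilbert_sum K) (operator_sum H K T)"
proof -
  interpret H: hilbert_family H by fact
  interpret K: hilbert_family K by fact
  note TD = linear_operatorD[OF T]
  have D: "f \<in> Dom (operator_sum H K T) \<longleftrightarrow> f \<in> carr (hilbert_sum H) \<and> (\<forall>n. f n \<in> Dom (T n)) \<and>
      (\<lambda>n. app (T n) (f n)) \<in> carr (hilbert_sum K)" for f
    using TD(5) by (auto simp: operator_sum_def K.mem_sum_iff)
  have app: "app (operator_sum H K T) f = (\<lambda>n. app (T n) (f n))" for f
    by (simp add: operator_sum_def)
  have zero: "0 \<in> Dom (operator_sum H K T)"
    unfolding D using TD(1) linear_operator_zero[OF T] H.sum.carr_zero K.sum.carr_zero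
    by (simp add: zero_fun_def)
  have add: "f + g \<in> Dom (operator_sum H K T) \<and>
      app (operator_sum H K T) (f + g) = app (operator_sum H K T) f + app (operator_sum H K T) g"
    if fg: "f \<in> Dom (operator_sum H K T)" "g \<in> Dom (operator_sum H K T)" for f g
  proof -
    have "(\<lambda>n. app (T n) ((f + g) n)) = (\<lambda>n. app (T n) (f n)) + (\<lambda>n. app (T n) (g n))"
      using fg TD(6) by (simp add: D plus_fun_def)
    then show ?thesis
      using fg H.sum.carr_add[of f g] K.sum.carr_add TD(2) by (simp add: D app)
  qed
  have scale: "c *\<^sub>C f \<in> Dom (operator_sum H K T) \<and>
      app (operator_sum H K T) (c *\<^sub>C f) = c *\<^sub>C app (operator_sum H K T) f"
    if f: "f \<in> Dom (operator_sum H K T)" for c f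
  proof -
    have "(\<lambda>n. app (T n) ((c *\<^sub>C f) n)) = c *\<^sub>C (\<lambda>n. app (T n) (f n))"
      using f TD(7) by (simp add: D scaleC_fun_def)
    then show ?thesis
      using f H.sum.carr_scale[of f c] K.sum.carr_scale TD(3)
      by (simp add: D app) (simp add: scaleC_fun_def)
  qed
  have "Dom (operator_sum H K T) \<subseteq> carr (hilbert_sum H)"
    "app (operator_sum H K T) ` Dom (operator_sum H K T) \<subseteq> carr (hilbert_sum K)"
    using D app by auto
  then show ?thesis
    unfolding linear_operator_def csubspace_def using zero add scale by blast
qed

lemma bij_betw_at_index:
  assumes "\<And>n. 0 \<notin> B n"
  shows "bij_betw (\<lambda>(n, b). at_index n b) (SIGMA n:UNIV. B n) (\<Union>n. at_index n ` B n)"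
  unfolding bij_betw_def
proof
  show "inj_on (\<lambda>(n, b). at_index n b) (SIGMA n:UNIV. B n)"
    using assms by (auto simp: inj_on_def) (metis at_index_inject)+
qed force

lemma (in hilbert_family) orthonormal_basis_sum:
  assumes B: "\<And>n. orthonormal_basis (H n) (V n) (B n)"
    and V: "\<And>n. V n \<subseteq> carr (H n)"
    and W: "W \<subseteq> carr (hilbert_sum H)" "\<And>f n. f \<in> W \<Longrightarrow> f n \<in> V n"
      "\<And>n x. x \<in> V n \<Longrightarrow> at_index n x \<in> W"
  shows "orthonormal_basis (hilbert_sum H) W (\<Union>n. at_index n ` B n)" "0 \<notin> B n"
proof -
  have BV: "b \<in> V n" "b \<in> carr (H n)" if "b \<in> B n" for n b
    using B[of n] V that by (auto simp: orthonormal_basis_def)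
  have on: "ip (H n) b c = (if b = c then 1 else 0)" if "b \<in> B n" "c \<in> B n" for n b c
    using B[of n] that by (simp add: orthonormal_basis_def)
  have nz: "0 \<notin> B n" for n
    using on[of 0 n 0] comp.ip_zero_left[OF comp.carr_zero, of n] by auto
  then show "0 \<notin> B n" .
  show "orthonormal_basis (hilbert_sum H) W (\<Union>n. at_index n ` B n)"
    unfolding orthonormal_basis_def
  proof (intro conjI ballI impI)
    show "(\<Union>n. at_index n ` B n) \<subseteq> W" using BV W(3) by blast
    show "ip (hilbert_sum H) x y = (if x = y then 1 else 0)"
      if xy: "x \<in> (\<Union>n. at_index n ` B n)" "y \<in> (\<Union>n. at_index n ` B n)" for x y
    proof -
      obtain n b m c where b: "b \<in> B n" "x = at_index n b" and c: "c \<in> B m" "y = at_index m c"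
        using xy by blast
      have "ip (hilbert_sum H) x y = ip (H m) (at_index n b m) c"
        using b c BV by (simp add: ip_at_index at_index_carr)
      moreover have "b \<noteq> 0" using b nz by metis
      ultimately show ?thesis
        using b c BV on by (auto simp: at_index_apply at_index_inject comp.ip_zero_left)
    qed
    fix x assume x: "x \<in> W" and orth: "\<forall>b\<in>\<Union>n. at_index n ` B n. ip (hilbert_sum H) x b = 0"
    have "x n = 0" for n
    proof -
      have "ip (H n) (x n) b = 0" if "b \<in> B n" for b
        using orth that ip_at_index[of x n b] W(1) x by force
      then show ?thesis using B[of n] W(2)[OF x] by (simp add: orthonormal_basis_def)
    qed
    then show "x = 0" by (simp add: fun_eq_iff zero_fun_def)
  qed
qed

lemma operator_sum_sel:
  "Dom (operator_sum H K T) = {f \<in> carr (hilbert_sum H). (\<forall>n. f n \<in> Dom (T n)) \<and>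
    summable (\<lambda>n. (hnorm (K n) (app (T n) (f n)))\<^sup>2)}"
  "app (operator_sum H K T) = (\<lambda>f n. app (T n) (f n))"
  by (simp_all add: operator_sum_def)

section \<open>Direct sums of boundary triplets\<close>

locale boundary_triplet_family =
  fixes H :: "nat \<Rightarrow> 'a::complex_vector inner_space"
    and S :: "nat \<Rightarrow> ('a, 'a) operator"
    and G :: "nat \<Rightarrow> 'b::complex_vector inner_space"
    and \<Gamma>0 \<Gamma>1 :: "nat \<Rightarrow> ('a, 'b) operator"
  assumes triplet: "boundary_triplet (H n) (S n) (G n) (\<Gamma>0 n) (\<Gamma>1 n)"
begin

sublocale bt: boundary_triplet "H n" "S n" "G n" "\<Gamma>0 n" "\<Gamma>1 n" for n
  by (rule triplet)

sublocale H: hilbert_family H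
  by unfold_locales

sublocale G: hilbert_family G
  by unfold_locales

abbreviation A where "A \<equiv> operator_sum H H S"
abbreviation A_adj where "A_adj \<equiv> op_adjoint (hilbert_sum H) A"
abbreviation \<Gamma>0_sum where "\<Gamma>0_sum \<equiv> boundary_map_sum H S G \<Gamma>0"
abbreviation \<Gamma>1_sum where "\<Gamma>1_sum \<equiv> boundary_map_sum H S G \<Gamma>1"

lemma A_adj_Dom_iff:
  "f \<in> Dom A_adj \<longleftrightarrow> f \<in> carr (hilbert_sum H) \<and> (\<forall>n. f n \<in> Dom (bt.T n)) \<and>
    (\<lambda>n. app (bt.T n) (f n)) \<in> carr (hilbert_sum H)"
  using bt.TD(5)
  by (auto simp: op_adjoint_operator_sum(1)[OF H.hilbert bt.linear_S bt.dense_S] operator_sum_sel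
      H.mem_sum_iff)

lemma A_adj_app: "f \<in> Dom A_adj \<Longrightarrow> app A_adj f = (\<lambda>n. app (bt.T n) (f n))"
  using op_adjoint_operator_sum[OF H.hilbert bt.linear_S bt.dense_S]
  by (simp add: operator_sum_sel)

lemma at_index_A_adj:
  assumes f: "f \<in> Dom (bt.T n)"
  shows "at_index n f \<in> Dom A_adj" "app A_adj (at_index n f) = at_index n (app (bt.T n) f)"
proof -
  have eq: "(\<lambda>m. app (bt.T m) (at_index n f m)) = at_index n (app (bt.T n) f)"
    using linear_operator_zero[OF bt.linear_T] by (auto simp: at_index_apply)
  show *: "at_index n f \<in> Dom A_adj"
    unfolding A_adj_Dom_iff eq using f bt.TD
    by (simp add: H.at_index_carr at_index_apply)
  show "app A_adj (at_index n f) = at_index n (app (bt.T n) f)"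
    using A_adj_app[OF *] eq by simp
qed

lemma ker_shift_sum_iff:
  "f \<in> ker_shift A_adj z \<longleftrightarrow> f \<in> carr (hilbert_sum H) \<and> (\<forall>n. f n \<in> ker_shift (bt.T n) z)"
proof -
  have "(\<lambda>n. app (bt.T n) (f n)) \<in> carr (hilbert_sum H)"
    if "f \<in> carr (hilbert_sum H)" "\<And>n. f n \<in> ker_shift (bt.T n) z"
  proof -
    have "(\<lambda>n. app (bt.T n) (f n)) = z *\<^sub>C f"
      using that(2) by (simp add: bt.ker_shift_iff scaleC_fun_def)
    then show ?thesis using H.sum.carr_scale[OF that(1)] by simp
  qed
  then show ?thesis
    by (auto simp: ker_shift_def A_adj_Dom_iff A_adj_app scaleC_fun_def fun_diff_def zero_fun_def
        fun_eq_iff)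
qed

lemma deficiency_A: "equal_deficiency_indices (hilbert_sum H) A"
proof -
  have "\<forall>n. \<exists>B C \<phi>. orthonormal_basis (H n) (ker_shift (bt.T n) \<i>) B \<and>
      orthonormal_basis (H n) (ker_shift (bt.T n) (- \<i>)) C \<and> bij_betw \<phi> B C"
    using bt.deficiency_S by (simp add: equal_deficiency_indices_def)
  then obtain B C \<phi> where B: "\<And>n. orthonormal_basis (H n) (ker_shift (bt.T n) \<i>) (B n)"
    and C: "\<And>n. orthonormal_basis (H n) (ker_shift (bt.T n) (- \<i>)) (C n)"
    and \<phi>: "\<And>n. bij_betw (\<phi> n) (B n) (C n)" by metis
  have sub: "ker_shift (bt.T n) z \<subseteq> carr (H n)" for n z
    using bt.TD(4) by (auto simp: bt.ker_shift_iff)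
  have sum_sub: "ker_shift A_adj z \<subseteq> carr (hilbert_sum H)" for z
    by (auto simp: ker_shift_sum_iff)
  have sum_comp: "f n \<in> ker_shift (bt.T n) z" if "f \<in> ker_shift A_adj z" for f n z
    using that by (simp add: ker_shift_sum_iff)
  have sum_at: "at_index n x \<in> ker_shift A_adj z" if "x \<in> ker_shift (bt.T n) z" for x n z
    using that sub[of n z] bt.TD(1) linear_operator_zero[OF bt.linear_T]
    by (auto simp: ker_shift_sum_iff H.at_index_carr at_index_apply bt.ker_shift_iff scaleC_zero_right)
  have onb: "orthonormal_basis (hilbert_sum H) (ker_shift A_adj z) (\<Union>n. at_index n ` D n)" "0 \<notin> D m"
    if "\<And>n. orthonormal_basis (H n) (ker_shift (bt.T n) z) (D n)" for z D m
    by (rule H.orthonormal_basis_sum[of "\<lambda>n. ker_shift (bt.T n) z" D "ker_shift A_adj z"];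
        fact that sub sum_sub sum_comp sum_at)+
  have B0: "0 \<notin> B n" and C0: "0 \<notin> C n" for n using onb(2) B C by blast+
  have im: "\<phi> n ` B n = C n" and inj: "inj_on (\<phi> n) (B n)" for n
    using \<phi>[of n] by (simp_all add: bij_betw_def)
  have "bij_betw (\<lambda>(n, b). (n, \<phi> n b)) (SIGMA n:UNIV. B n) (SIGMA n:UNIV. C n)"
    unfolding bij_betw_def
  proof
    show "inj_on (\<lambda>(n, b). (n, \<phi> n b)) (SIGMA n:UNIV. B n)"
      using inj by (auto simp: inj_on_def)
    show "(\<lambda>(n, b). (n, \<phi> n b)) ` (SIGMA n:UNIV. B n) = (SIGMA n:UNIV. C n)"
      by (auto simp: image_iff simp flip: im)
  qed
  from bij_betw_trans[OF bij_betw_inv_into[OF bij_betw_at_index[OF B0]]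
      bij_betw_trans[OF this bij_betw_at_index[OF C0]]]
  show ?thesis
    unfolding equal_deficiency_indices_def using onb(1)[OF B] onb(1)[OF C] by blast
qed

lemma graph_norm_sum:
  assumes f: "f \<in> Dom A_adj"
  shows "(\<lambda>n. (bt.graph_norm n (f n))\<^sup>2) sums
    ((hnorm (hilbert_sum H) f)\<^sup>2 + (hnorm (hilbert_sum H) (app A_adj f))\<^sup>2)"
proof -
  have "f \<in> carr (hilbert_sum H)" "(\<lambda>n. app (bt.T n) (f n)) \<in> carr (hilbert_sum H)"
    using f by (simp_all add: A_adj_Dom_iff)
  then show ?thesis
    unfolding A_adj_app[OF f]
    by (simp add: H.hnorm_sum_power2 H.mem_sum_iff sums_add summable_sums)
qed

lemma boundary_map_sum_app: "app (boundary_map_sum H S G \<Gamma>) f = (\<lambda>n. app (\<Gamma> n) (f n))"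
  by (simp add: boundary_map_sum_def op_restrict_def operator_sum_sel)

lemma boundary_map_sum_bounded:
  assumes lin: "\<And>n. linear_operator (H n) (G n) (\<Gamma> n)"
    and dom: "\<And>n. Dom (\<Gamma> n) = Dom (bt.T n)"
    and K: "K \<ge> 0" "\<And>n f. f \<in> Dom (bt.T n) \<Longrightarrow> hnorm (G n) (app (\<Gamma> n) f) \<le> K * bt.graph_norm n f"
  shows "Dom (boundary_map_sum H S G \<Gamma>) = Dom A_adj"
    and "linear_operator (hilbert_sum H) (hilbert_sum G) (boundary_map_sum H S G \<Gamma>)"
    and "graph_bounded (hilbert_sum H) A_adj (hilbert_sum G) (boundary_map_sum H S G \<Gamma>)"
proof -
  let ?N = "\<lambda>f. sqrt ((hnorm (hilbert_sum H) f)\<^sup>2 + (hnorm (hilbert_sum H) (app A_adj f))\<^sup>2)"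
  have *: "(\<lambda>n. app (\<Gamma> n) (f n)) \<in> carr (hilbert_sum G) \<and>
      hnorm (hilbert_sum G) (\<lambda>n. app (\<Gamma> n) (f n)) \<le> K * ?N f"
    if f: "f \<in> Dom A_adj" for f
  proof -
    have fn: "f n \<in> Dom (bt.T n)" for n using f by (simp add: A_adj_Dom_iff)
    have c: "app (\<Gamma> n) (f n) \<in> carr (G n)" for n using linear_operatorD(5)[OF lin] fn dom by simp
    have sums: "(\<lambda>n. K\<^sup>2 * (bt.graph_norm n (f n))\<^sup>2) sums (K * ?N f)\<^sup>2"
      using sums_mult[OF graph_norm_sum[OF f], of "K\<^sup>2"] by (simp add: power_mult_distrib)
    have le: "(hnorm (G n) (app (\<Gamma> n) (f n)))\<^sup>2 \<le> K\<^sup>2 * (bt.graph_norm n (f n))\<^sup>2" for n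
      using power_mono[OF K(2)[OF fn] bt.G.hnorm_nonneg[OF c], of n 2]
      by (simp only: power_mult_distrib)
    have summable: "summable (\<lambda>n. (hnorm (G n) (app (\<Gamma> n) (f n)))\<^sup>2)"
      by (rule summable_comparison_test'[OF sums_summable[OF sums]]) (use le in simp)
    then have mem: "(\<lambda>n. app (\<Gamma> n) (f n)) \<in> carr (hilbert_sum G)" using c by (simp add: G.mem_sum_iff)
    have "(hnorm (hilbert_sum G) (\<lambda>n. app (\<Gamma> n) (f n)))\<^sup>2 \<le> (K * ?N f)\<^sup>2"
      unfolding G.hnorm_sum_power2[OF mem] sums_unique[OF sums]
      by (rule suminf_le[OF le summable sums_summable[OF sums]])
    then show ?thesis using mem K(1) by (auto intro: power2_le_imp_le)
  qed
  show Dom: "Dom (boundary_map_sum H S G \<Gamma>) = Dom A_adj"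
    using * dom
    by (auto simp: boundary_map_sum_def op_restrict_def operator_sum_sel A_adj_Dom_iff G.mem_sum_iff)
  have "csubspace (Dom A_adj)"
    using linear_operator_sum[OF H.hilbert_family_axioms H.hilbert_family_axioms bt.linear_T]
    unfolding linear_operator_def op_adjoint_operator_sum(1)[OF H.hilbert bt.linear_S bt.dense_S]
    by blast
  then show "linear_operator (hilbert_sum H) (hilbert_sum G) (boundary_map_sum H S G \<Gamma>)"
    unfolding boundary_map_sum_def
    by (rule linear_operator_restrict[OF
          linear_operator_sum[OF H.hilbert_family_axioms G.hilbert_family_axioms lin]])
  show "graph_bounded (hilbert_sum H) A_adj (hilbert_sum G) (boundary_map_sum H S G \<Gamma>)"
    unfolding graph_bounded_def Dom boundary_map_sum_app using * by blast
qed

lemma boundary_triplet_sum_if_weyl_bounds: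
  assumes C: "C \<ge> 1"
    and W: "\<And>n g. g \<in> carr (G n) \<Longrightarrow> hnorm (G n) (app (bt.weyl n \<i>) g) \<le> C * hnorm (G n) g"
    and B: "\<And>n g. g \<in> carr (G n) \<Longrightarrow> hnorm (G n) g \<le> C * hnorm (G n) (app (bt.Im_weyl n) g)"
  shows "boundary_triplet (hilbert_sum H) A (hilbert_sum G) \<Gamma>0_sum \<Gamma>1_sum"
proof -
  have K: "0 \<le> 5 * C ^ 3" using C by simp
  have bound: "hnorm (G n) (app (\<Gamma>0 n) f) \<le> 5 * C ^ 3 * bt.graph_norm n f"
    "hnorm (G n) (app (\<Gamma>1 n) f) \<le> 5 * C ^ 3 * bt.graph_norm n f" if "f \<in> Dom (bt.T n)" for n f
    using bt.graph_bounds_if_weyl_bounds[OF C _ _ that] W B by blast+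
  have b0: "Dom \<Gamma>0_sum = Dom A_adj" "linear_operator (hilbert_sum H) (hilbert_sum G) \<Gamma>0_sum"
    "graph_bounded (hilbert_sum H) A_adj (hilbert_sum G) \<Gamma>0_sum"
    using boundary_map_sum_bounded[OF bt.linear_\<Gamma>0 bt.Dom_\<Gamma>0 K] bound(1) by blast+
  have b1: "Dom \<Gamma>1_sum = Dom A_adj" "linear_operator (hilbert_sum H) (hilbert_sum G) \<Gamma>1_sum"
    "graph_bounded (hilbert_sum H) A_adj (hilbert_sum G) \<Gamma>1_sum"
    using boundary_map_sum_bounded[OF bt.linear_\<Gamma>1 bt.Dom_\<Gamma>1 K] bound(2) by blast+
  have Gamma_sum: "(\<lambda>n. app (\<Gamma>0 n) (f n)) \<in> carr (hilbert_sum G)"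
    "(\<lambda>n. app (\<Gamma>1 n) (f n)) \<in> carr (hilbert_sum G)" if "f \<in> Dom A_adj" for f
    using linear_operatorD(5)[OF b0(2), of f] linear_operatorD(5)[OF b1(2), of f] that
    by (simp_all add: b0(1) b1(1) boundary_map_sum_app)
  show ?thesis
  proof unfold_locales
    show "linear_operator (hilbert_sum H) (hilbert_sum H) A"
      by (rule linear_operator_sum[OF H.hilbert_family_axioms H.hilbert_family_axioms bt.linear_S])
    show "densely_defined (hilbert_sum H) A"
      using bt.linear_S bt.dense_S linear_operatorD(1,4)[OF bt.linear_S] linear_operator_zero[OF bt.linear_S]
      by (intro H.densely_defined_operator_sum) (auto simp: bt.H.hnorm_zero)
    show "closed_operator (hilbert_sum H) A"
      using bt.closed_S linear_operatorD(5)[OF bt.linear_S] by (intro H.closed_operator_sum) auto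
    show "symmetric_operator (hilbert_sum H) A"
      by (rule H.symmetric_operator_sum[OF bt.symmetric_S])
    show "equal_deficiency_indices (hilbert_sum H) A" by (rule deficiency_A)
    show "linear_operator (hilbert_sum H) (hilbert_sum G) \<Gamma>0_sum"
      "linear_operator (hilbert_sum H) (hilbert_sum G) \<Gamma>1_sum" by (rule b0(2)) (rule b1(2))
    show "Dom \<Gamma>0_sum = Dom A_adj" "Dom \<Gamma>1_sum = Dom A_adj" by (rule b0(1)) (rule b1(1))
    show "graph_bounded (hilbert_sum H) A_adj (hilbert_sum G) \<Gamma>0_sum"
      "graph_bounded (hilbert_sum H) A_adj (hilbert_sum G) \<Gamma>1_sum" by (rule b0(3)) (rule b1(3))
    show "ip (hilbert_sum H) (app A_adj f) g - ip (hilbert_sum H) f (app A_adj g) =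
        ip (hilbert_sum G) (app \<Gamma>1_sum f) (app \<Gamma>0_sum g) - ip (hilbert_sum G) (app \<Gamma>0_sum f) (app \<Gamma>1_sum g)"
      if f: "f \<in> Dom A_adj" and g: "g \<in> Dom A_adj" for f g
    proof -
      have "f n \<in> Dom (bt.T n)" "g n \<in> Dom (bt.T n)" for n using f g by (simp_all add: A_adj_Dom_iff)
      note green = bt.green[OF this]
      have "f \<in> carr (hilbert_sum H)" "g \<in> carr (hilbert_sum H)"
        "(\<lambda>n. app (bt.T n) (f n)) \<in> carr (hilbert_sum H)" "(\<lambda>n. app (bt.T n) (g n)) \<in> carr (hilbert_sum H)"
        using f g by (simp_all add: A_adj_Dom_iff)
      then show ?thesis
        using Gamma_sum[OF f] Gamma_sum[OF g]
        by (simp add: A_adj_app f g boundary_map_sum_app H.ip_sum G.ip_sum suminf_diff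
            H.summable_ip G.summable_ip green)
    qed
    show "(\<lambda>f. (app \<Gamma>0_sum f, app \<Gamma>1_sum f)) ` Dom A_adj = carr (hilbert_sum G) \<times> carr (hilbert_sum G)"
    proof
      show "(\<lambda>f. (app \<Gamma>0_sum f, app \<Gamma>1_sum f)) ` Dom A_adj \<subseteq> carr (hilbert_sum G) \<times> carr (hilbert_sum G)"
        using Gamma_sum by (auto simp: boundary_map_sum_app)
      show "carr (hilbert_sum G) \<times> carr (hilbert_sum G) \<subseteq> (\<lambda>f. (app \<Gamma>0_sum f, app \<Gamma>1_sum f)) ` Dom A_adj"
      proof clarify
        fix g h assume g: "g \<in> carr (hilbert_sum G)" and h: "h \<in> carr (hilbert_sum G)"
        let ?K = "3 * C ^ 3" and ?s = "\<lambda>n. hnorm (G n) (g n) + hnorm (G n) (h n)"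
        have "\<forall>n. \<exists>f. f \<in> Dom (bt.T n) \<and> app (\<Gamma>0 n) f = g n \<and> app (\<Gamma>1 n) f = h n \<and>
            hnorm (H n) f \<le> ?K * ?s n \<and> hnorm (H n) (app (bt.T n) f) \<le> ?K * ?s n"
          using bt.boundary_values_lift[OF C W B G.sum_comp_carr[OF g] G.sum_comp_carr[OF h]] by metis
        then obtain f where f: "\<And>n. f n \<in> Dom (bt.T n)" "\<And>n. app (\<Gamma>0 n) (f n) = g n"
          "\<And>n. app (\<Gamma>1 n) (f n) = h n" "\<And>n. hnorm (H n) (f n) \<le> ?K * ?s n"
          "\<And>n. hnorm (H n) (app (bt.T n) (f n)) \<le> ?K * ?s n" by metis
        let ?b = "\<lambda>n. ?K\<^sup>2 * (2 * (hnorm (G n) (g n))\<^sup>2 + 2 * (hnorm (G n) (h n))\<^sup>2)"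
        have dominating: "summable ?b"
          using g h by (intro summable_mult summable_add) (simp_all add: G.mem_sum_iff)
        have mem: "u \<in> carr (hilbert_sum H)"
          if u: "\<And>n. u n \<in> carr (H n)" "\<And>n. hnorm (H n) (u n) \<le> ?K * ?s n" for u
        proof -
          have "norm ((hnorm (H n) (u n))\<^sup>2) \<le> ?b n" for n
          proof -
            have "(hnorm (H n) (u n))\<^sup>2 \<le> ?K\<^sup>2 * (?s n)\<^sup>2"
              using power_mono[OF u(2) bt.H.hnorm_nonneg[OF u(1)], of n 2]
              by (simp only: power_mult_distrib)
            also have "(?s n)\<^sup>2 \<le> 2 * (hnorm (G n) (g n))\<^sup>2 + 2 * (hnorm (G n) (h n))\<^sup>2"
              using sum_squares_bound[of "hnorm (G n) (g n)" "hnorm (G n) (h n)"]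
              unfolding power2_sum by linarith
            finally show ?thesis by (simp add: mult_left_mono)
          qed
          then have "summable (\<lambda>n. (hnorm (H n) (u n))\<^sup>2)"
            by (rule summable_comparison_test'[OF dominating])
          then show ?thesis using u(1) by (simp add: H.mem_sum_iff)
        qed
        have "f \<in> Dom A_adj"
          unfolding A_adj_Dom_iff
          by (intro conjI allI f(1) mem bt.TD(4)[OF f(1)] bt.TD(5)[OF f(1)] f(4,5))
        moreover have "app \<Gamma>0_sum f = g" "app \<Gamma>1_sum f = h" by (simp_all add: boundary_map_sum_app f)
        ultimately show "(g, h) \<in> (\<lambda>f. (app \<Gamma>0_sum f, app \<Gamma>1_sum f)) ` Dom A_adj" by force
      qed
    qed
  qed
qed

lemma graph_bound_comp:
  assumes lin: "\<And>n. linear_operator (H n) (G n) (\<Gamma> n)"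
    and dom: "Dom (boundary_map_sum H S G \<Gamma>) = Dom A_adj"
    and bounded: "graph_bounded (hilbert_sum H) A_adj (hilbert_sum G) (boundary_map_sum H S G \<Gamma>)"
  obtains C where "\<And>n f. f \<in> Dom (bt.T n) \<Longrightarrow> hnorm (G n) (app (\<Gamma> n) f) \<le> C * bt.graph_norm n f"
proof -
  obtain C where C: "\<And>f. f \<in> Dom A_adj \<Longrightarrow> hnorm (hilbert_sum G) (\<lambda>n. app (\<Gamma> n) (f n)) \<le>
      C * sqrt ((hnorm (hilbert_sum H) f)\<^sup>2 + (hnorm (hilbert_sum H) (app A_adj f))\<^sup>2)"
    using bounded unfolding graph_bounded_def dom boundary_map_sum_app by blast
  have "hnorm (G n) (app (\<Gamma> n) f) \<le> C * bt.graph_norm n f" if f: "f \<in> Dom (bt.T n)" for n f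
  proof -
    have fc: "f \<in> carr (H n)" "app (bt.T n) f \<in> carr (H n)" using f bt.TD(4,5) by blast+
    have "at_index n f \<in> Dom (boundary_map_sum H S G \<Gamma>)" using at_index_A_adj(1)[OF f] dom by simp
    then have "at_index n f n \<in> Dom (\<Gamma> n)"
      by (simp add: boundary_map_sum_def op_restrict_def operator_sum_sel)
    then have gc: "app (\<Gamma> n) f \<in> carr (G n)" using linear_operatorD(5)[OF lin] by (simp add: at_index_apply)
    have "(\<lambda>m. app (\<Gamma> m) (at_index n f m)) = at_index n (app (\<Gamma> n) f)"
      using linear_operator_zero[OF lin] by (auto simp: at_index_apply)
    then show ?thesis
      using C[OF at_index_A_adj(1)[OF f]] fc gc
      by (simp add: at_index_A_adj(2)[OF f] H.hnorm_at_index G.hnorm_at_index)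
  qed
  then show ?thesis using that by blast
qed

lemma weyl_bounds_if_boundary_triplet_sum:
  assumes "boundary_triplet (hilbert_sum H) A (hilbert_sum G) \<Gamma>0_sum \<Gamma>1_sum"
  obtains C where "C \<ge> 0"
    "\<And>n g. g \<in> carr (G n) \<Longrightarrow> hnorm (G n) (app (bt.weyl n \<i>) g) \<le> C * hnorm (G n) g"
    "\<And>n g. g \<in> carr (G n) \<Longrightarrow> hnorm (G n) g \<le> C * hnorm (G n) (app (bt.Im_weyl n) g)"
proof -
  interpret sum_bt: boundary_triplet "hilbert_sum H" A "hilbert_sum G" \<Gamma>0_sum \<Gamma>1_sum by fact
  obtain C0 where C0: "\<And>n f. f \<in> Dom (bt.T n) \<Longrightarrow> hnorm (G n) (app (\<Gamma>0 n) f) \<le> C0 * bt.graph_norm n f"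
    using graph_bound_comp[OF bt.linear_\<Gamma>0 sum_bt.Dom_\<Gamma>0 sum_bt.bounded_\<Gamma>0] by blast
  obtain C1 where C1: "\<And>n f. f \<in> Dom (bt.T n) \<Longrightarrow> hnorm (G n) (app (\<Gamma>1 n) f) \<le> C1 * bt.graph_norm n f"
    using graph_bound_comp[OF bt.linear_\<Gamma>1 sum_bt.Dom_\<Gamma>1 sum_bt.bounded_\<Gamma>1] by blast
  define C where "C = max C0 C1"
  have "C0 * bt.graph_norm n f \<le> C * bt.graph_norm n f" "C1 * bt.graph_norm n f \<le> C * bt.graph_norm n f" for n f
    by (intro mult_right_mono; simp add: C_def)+
  then have C: "hnorm (G n) (app (\<Gamma>0 n) f) \<le> C * bt.graph_norm n f"
    "hnorm (G n) (app (\<Gamma>1 n) f) \<le> C * bt.graph_norm n f" if "f \<in> Dom (bt.T n)" for n f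
    using C0[OF that] C1[OF that] order_trans by blast+
  show ?thesis
    using that[of "2 * C\<^sup>2"] bt.weyl_bounds_if_graph_bounds[OF C] by simp
qed

end

theorem theorem3p10:
  fixes H :: "nat \<Rightarrow> 'a::complex_vector inner_space"
    and S :: "nat \<Rightarrow> ('a, 'a) operator"
    and G :: "nat \<Rightarrow> 'b::complex_vector inner_space"
    and \<Gamma>0 \<Gamma>1 :: "nat \<Rightarrow> ('a, 'b) operator"
    and M :: "nat \<Rightarrow> complex \<Rightarrow> ('b, 'b) operator"
  assumes "\<And>n. complex_hilbert_space (H n)"
    and "\<And>n. linear_operator (H n) (H n) (S n)"
    and "\<And>n. densely_defined (H n) (S n)"
    and "\<And>n. closed_operator (H n) (S n)"
    and "\<And>n. symmetric_operator (H n) (S n)"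
    and "\<And>n. equal_deficiency_indices (H n) (S n)"
    and "\<And>n. boundary_triplet (H n) (S n) (G n) (\<Gamma>0 n) (\<Gamma>1 n)"
    and "\<And>n. M n = weyl_function (H n) (S n) (\<Gamma>0 n) (\<Gamma>1 n)"
  shows "boundary_triplet (hilbert_sum H) (operator_sum H H S) (hilbert_sum G)
           (boundary_map_sum H S G \<Gamma>0) (boundary_map_sum H S G \<Gamma>1)
         \<longleftrightarrow>
         (SUP n. op_norm (G n) (G n) (M n \<i>)) < \<infinity> \<and>
         (SUP n. op_norm (G n) (G n) (op_inverse (op_Im (G n) (M n \<i>)))) < \<infinity>"
    (is "?triplet \<longleftrightarrow> ?C3 \<and> ?C4")
proof -
  interpret boundary_triplet_family H S G \<Gamma>0 \<Gamma>1
    by (rule boundary_triplet_family.intro) (rule assms(7))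
  have M: "M n = bt.weyl n" for n by (rule assms(8))
  have C3: "?C3 \<longleftrightarrow> (\<exists>C\<ge>0. \<forall>n. \<forall>g\<in>carr (G n).
      hnorm (G n) (app (bt.weyl n \<i>) g) \<le> C * hnorm (G n) g)"
    using SUP_op_norm_finite_iff[OF G.hilbert G.hilbert bt.linear_weyl, of "\<lambda>_. \<i>"]
    by (simp add: M bt.Dom_weyl)
  have "app (op_inverse (bt.Im_weyl n)) (app (bt.Im_weyl n) g) = g" if "g \<in> carr (G n)" for n g
    using bt.Im_weyl_inj[of n] that by (simp add: op_inverse_def bt.Dom_Im_weyl)
  moreover have "Dom (op_inverse (bt.Im_weyl n)) = app (bt.Im_weyl n) ` carr (G n)" for n
    by (simp add: op_inverse_def bt.Dom_Im_weyl)
  moreover have "linear_operator (G n) (G n) (op_inverse (bt.Im_weyl n))" for n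
    by (rule linear_operator_inverse[OF bt.linear_Im_weyl bt.Im_weyl_inj])
  note SUP_op_norm_finite_iff[where T = "\<lambda>n. op_inverse (bt.Im_weyl n)", OF G.hilbert G.hilbert this]
  ultimately have C4: "?C4 \<longleftrightarrow> (\<exists>C\<ge>0. \<forall>n. \<forall>g\<in>carr (G n).
      hnorm (G n) g \<le> C * hnorm (G n) (app (bt.Im_weyl n) g))"
    by (simp add: M)
  show ?thesis
  proof
    assume ?triplet
    then show "?C3 \<and> ?C4"
      unfolding C3 C4 by (rule weyl_bounds_if_boundary_triplet_sum) blast
  next
    assume "?C3 \<and> ?C4"
    then obtain C D where
      C: "\<And>n g. g \<in> carr (G n) \<Longrightarrow> hnorm (G n) (app (bt.weyl n \<i>) g) \<le> C * hnorm (G n) g" and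
      D: "\<And>n g. g \<in> carr (G n) \<Longrightarrow> hnorm (G n) g \<le> D * hnorm (G n) (app (bt.Im_weyl n) g)"
      unfolding C3 C4 by blast
    define E where "E = max 1 (max C D)"
    show ?triplet
    proof (rule boundary_triplet_sum_if_weyl_bounds)
      show "1 \<le> E" by (simp add: E_def)
      fix n g assume g: "g \<in> carr (G n)"
      show "hnorm (G n) (app (bt.weyl n \<i>) g) \<le> E * hnorm (G n) g"
        by (rule order_trans[OF C[OF g]], rule mult_right_mono)
          (simp_all add: E_def bt.G.hnorm_nonneg g)
      show "hnorm (G n) g \<le> E * hnorm (G n) (app (bt.Im_weyl n) g)"
        by (rule order_trans[OF D[OF g]], rule mult_right_mono)
          (simp_all add: E_def bt.G.hnorm_nonneg bt.Im_weyl_carr g)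
    qed
  qed
qed

end
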